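(* Let $(\Omega,f,w)$ be an invertible system, where $\Omega$ is a metric space, $w$ is uniformly continuous, and $f$ is distance-preserving. Let $X$ be an admissible space for $C_{w,f}$, generated by $W$. Then the weighted composition operator $C_{w,f}$ on $X$ has the shadowing property if and only if one of the following conditions holds: \begin{itemize} \item[(A)] $\lim_{n\to\infty}\|w^{[n]}\|_{\infty}^{\frac1n}<1$; \item[(B)] $\lim_{n\to\infty}\|w^{[-n]}\|_{\infty}^{\frac1n}<1$; \item[(C)] $\lim_{n\to\infty}\|w^{[n]}\|_{\infty,\,\Omega^{n}_{-}}^{\frac1n}<1$ and $\lim_{n\to\infty}\|w^{[-n]}\|_{\infty,\,\Omega^{n}_{+}}^{\frac1n}<1$. \end{itemize}
   Context: $\mathbb{K}$ is $\mathbb{R}$ or $\mathbb{C}$; $\mathbb{N}=\{1,2,\dots\}$, $\mathbb{N}_0=\mathbb{N}\cup\{0\}$; $\bigsqcup$ denotes a disjoint union. An (invertible) operator on a Banach space is a continuous (invertible) linear self-map. A map $f$ on a metric space $(\Omega,d)$ is distance-preserving if $d(f(x),f(y))=d(x,y)$ for all $x,y$. Shadowing: an invertible operator $T$ on a Banach space $X$ has the shadowing property if for every $\varepsilon>0$ there is $\delta>0$ such that for every sequence $(x_j)_{j\in\mathbb{Z}}$ in $X$ with $\|T(x_j)-x_{j+1}\|\le\delta$ for all $j\in\mathbb{Z}$ there is $x\in X$ with $\|x_j-T^j(x)\|<\varepsilon$ for all $j\in\mathbb{Z}$. Invertible system $(\Omega,f,w)$: $\Omega$ is a locally compact Hausdorff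 space; $w:\Omega\to\mathbb{K}$ is continuous with $0<\inf_{x\in\Omega}|w(x)|\le\sup_{x\in\Omega}|w(x)|<\infty$; $f:\Omega\to\Omega$ is a homeomorphism. Functions $w^{[n]}$, $n\in\mathbb{Z}$: $w^{[0]}=1$, $w^{[1]}=w$, $w^{[-1]}=\frac{1}{w\circ f^{-1}}$, and for $n\ge2$, $w^{[n]}=(w\circ f^{n-1})\,w^{[n-1]}$ and $w^{[-n]}=\frac{1}{w\circ f^{-n}}\,w^{[-(n-1)]}$. For a bounded map $\varphi:\Omega\to\mathbb{K}$ and $B\subset\Omega$, $\|\varphi\|_{\infty,B}=\sup_{x\in B}|\varphi(x)|$ (equal to $0$ if $B=\varnothing$), and $\|\varphi\|_\infty=\|\varphi\|_{\infty,\Omega}$. $\operatorname{supp}\varphi=\overline{\{x\in\Omega:\varphi(x)\ne0\}}$. $C_b(\Omega)$ is the Banach space of bounded continuous $\varphi:\Omega\to\mathbb{K}$ with norm $\|\cdot\|_\infty$, and $C_c(\Omega)$ is its subspace of functions with compact support. Admissible space: let $W\subset\Omega$ be a relatively compact, connected set with non-empty interior such that $W\subset\overline{\operatorname{int}(W)}$. Put $\Omega^n_+=\overline{\bigsqcup_{k=n}^\infty f^k(W)}$ and $\Omega^n_-=\overline{\bigsqcup_{k=n}^\infty f^{-k}(W)}$ for $n\in\mathbb{N}_0$. A closed subspace $X$ of $C_b(\Omega)$ is an admissible space for $C_{w,f}$, generated by $W$, if: (AS1) the weighted composition operator $C_{w,f}:X\to X$, $\varphi\mapsto(\varphi\circ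 f)w$, is an invertible operator; (AS2) $\Omega=\bigsqcup_{k\in\mathbb{Z}}f^k(W)$; (AS3) there exist continuous functions $\rho_-,\rho_+:\Omega\to\mathbb{K}$ such that $\rho_\pm\varphi\in X$ for all $\varphi\in X$, $\|\rho_\pm\|_\infty=1$, $\operatorname{supp}(\rho_-)=\Omega^0_-$, $\operatorname{supp}(\rho_+)=\Omega^0_+$ and $\rho_-+\rho_+\equiv1$; (AS4) for each $x\in\Omega$, the set $S_x=\{(\varphi(f^n(x)))_{n\in\mathbb{Z}}:\varphi\in X\}$ is closed in $\ell^\infty(\mathbb{Z})$, contains every canonical vector $e_n=(\delta_{n,j})_{j\in\mathbb{Z}}$, $n\in\mathbb{Z}$, and is invariant under the canonical projections $P_M,P_N$ of sequences onto the coordinates $n\le0$ and $n>0$ respectively (replacing the other coordinates by $0$); (AS5) $C_c(\Omega)\subset X$. *)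

theory Defs
  imports "HOL-Analysis.Analysis"
begin

text \<open>
  Scalars: the field of scalars is a type of class \<open>real_normed_field\<close> and
  \<open>euclidean_space\<close>. Both \<open>real\<close> and \<open>complex\<close> are instances; by the Gelfand--Mazur theorem
  every instance is isometrically isomorphic to one of these two.
  The Banach space of bounded continuous functions is the library type \<open>bcontfun\<close>.
\<close>

text \<open>
  Integer iterates of a bijective self-map of a set. For a weighted composition operator the set
  is the space the operator acts on; for a homeomorphism it is the whole type.
\<close>

definition ziter :: "'b set \<Rightarrow> ('b \<Rightarrow> 'b) \<Rightarrow> int \<Rightarrow> 'b \<Rightarrow> 'b" where
  "ziter X T n = (if 0 \<le> n then T ^^ nat n else inv_into X T ^^ nat (- n))"

definition shadowing_on :: "'b::real_normed_vector set \<Rightarrow> ('b \<Rightarrow> 'b) \<Rightarrow> bool" where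
  "shadowing_on X T \<longleftrightarrow>
     (\<forall>\<epsilon>>0. \<exists>\<delta>>0. \<forall>x :: int \<Rightarrow> 'b.
        (\<forall>j. x j \<in> X) \<and> (\<forall>j. norm (T (x j) - x (j + 1)) \<le> \<delta>) \<longrightarrow>
        (\<exists>y\<in>X. \<forall>j. norm (x j - ziter X T j y) < \<epsilon>))"

definition invertible_system :: "('a::t2_space \<Rightarrow> 'a) \<Rightarrow> ('a \<Rightarrow> 'k::real_normed_field) \<Rightarrow> bool" where
  "invertible_system f w \<longleftrightarrow>
     locally_compact_space (euclidean :: 'a topology) \<and>
     continuous_on UNIV w \<and>
     0 < (INF x. norm (w x)) \<and> bdd_above (range (\<lambda>x. norm (w x))) \<and>
     homeomorphism UNIV UNIV f (inv f)"

fun wprod_pos :: "('a \<Rightarrow> 'a) \<Rightarrow> ('a \<Rightarrow> 'k::field) \<Rightarrow> nat \<Rightarrow> 'a \<Rightarrow> 'k" where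
  "wprod_pos f w 0 x = 1"
| "wprod_pos f w (Suc n) x = w (ziter UNIV f (int n) x) * wprod_pos f w n x"

fun wprod_neg :: "('a \<Rightarrow> 'a) \<Rightarrow> ('a \<Rightarrow> 'k::field) \<Rightarrow> nat \<Rightarrow> 'a \<Rightarrow> 'k" where
  "wprod_neg f w 0 x = 1"
| "wprod_neg f w (Suc n) x = 1 / w (ziter UNIV f (- int (Suc n)) x) * wprod_neg f w n x"

definition wprod :: "('a \<Rightarrow> 'a) \<Rightarrow> ('a \<Rightarrow> 'k::field) \<Rightarrow> int \<Rightarrow> 'a \<Rightarrow> 'k" where
  "wprod f w n = (if 0 \<le> n then wprod_pos f w (nat n) else wprod_neg f w (nat (- n)))"

text \<open>Meaningful when \<open>\<phi>\<close> is bounded on \<open>B\<close>.\<close>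

definition supnorm_on :: "'a set \<Rightarrow> ('a \<Rightarrow> 'k::real_normed_vector) \<Rightarrow> real" where
  "supnorm_on B \<phi> = (if B = {} then 0 else (SUP x\<in>B. norm (\<phi> x)))"

definition supp :: "('a::topological_space \<Rightarrow> 'k::zero) \<Rightarrow> 'a set" where
  "supp \<phi> = closure {x. \<phi> x \<noteq> 0}"

definition Omega_plus :: "('a::topological_space \<Rightarrow> 'a) \<Rightarrow> 'a set \<Rightarrow> nat \<Rightarrow> 'a set" where
  "Omega_plus f W n = closure (\<Union>k\<in>{n..}. ziter UNIV f (int k) ` W)"

definition Omega_minus :: "('a::topological_space \<Rightarrow> 'a) \<Rightarrow> 'a set \<Rightarrow> nat \<Rightarrow> 'a set" where
  "Omega_minus f W n = closure (\<Union>k\<in>{n..}. ziter UNIV f (- int k) ` W)"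

lemma bcontfunI:
  fixes g :: "'a::topological_space \<Rightarrow> 'b::real_normed_vector"
  assumes "continuous_on UNIV g" "bounded (range g)"
  shows "g \<in> bcontfun"
  using assms by (simp add: bcontfun_def)

lemma bcontfun_mult:
  fixes g h :: "'a::topological_space \<Rightarrow> 'k::real_normed_field"
  assumes "g \<in> bcontfun" "h \<in> bcontfun"
  shows "(\<lambda>x. g x * h x) \<in> bcontfun"
proof (rule bcontfunI)
  show "continuous_on UNIV (\<lambda>x. g x * h x)"
    using assms by (auto simp: bcontfun_def intro: continuous_intros)
  obtain a b where a: "\<And>x. norm (g x) \<le> a" and b: "\<And>x. norm (h x) \<le> b"
    using assms by (auto simp: bcontfun_def bounded_iff)
  have "norm (g x * h x) \<le> a * b" for x
    unfolding norm_mult using a[of x] b[of x]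
    by (intro mult_mono) (auto intro: order_trans[OF norm_ge_zero])
  then show "bounded (range (\<lambda>x. g x * h x))"
    by (auto simp: bounded_iff)
qed

setup_lifting type_definition_bcontfun

lift_definition bc_mult ::
  "('a::topological_space \<Rightarrow>\<^sub>C 'k::real_normed_field) \<Rightarrow> ('a \<Rightarrow>\<^sub>C 'k) \<Rightarrow> ('a \<Rightarrow>\<^sub>C 'k)"
  is "\<lambda>g h x. g x * h x"
  by (rule bcontfun_mult)

text \<open>
  \<open>scaleR\<close> on \<open>bcontfun\<close> only covers real scalars, hence the scalar multiplication below.
\<close>

definition bc_scale ::
  "'k \<Rightarrow> ('a::topological_space \<Rightarrow>\<^sub>C 'k::real_normed_field) \<Rightarrow> ('a \<Rightarrow>\<^sub>C 'k)" where
  "bc_scale c = bc_mult (const_bcontfun c)"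

definition closed_subspace :: "('a::topological_space \<Rightarrow>\<^sub>C 'k::real_normed_field) set \<Rightarrow> bool" where
  "closed_subspace X \<longleftrightarrow>
     closed X \<and> 0 \<in> X \<and> (\<forall>\<phi>\<in>X. \<forall>\<psi>\<in>X. \<phi> + \<psi> \<in> X) \<and> (\<forall>c. \<forall>\<phi>\<in>X. bc_scale c \<phi> \<in> X)"

definition invertible_operator_on ::
  "('a::topological_space \<Rightarrow>\<^sub>C 'k::real_normed_field) set \<Rightarrow>
   (('a \<Rightarrow>\<^sub>C 'k) \<Rightarrow> ('a \<Rightarrow>\<^sub>C 'k)) \<Rightarrow> bool" where
  "invertible_operator_on X T \<longleftrightarrow>
     (\<forall>\<phi>\<in>X. \<forall>\<psi>\<in>X. T (\<phi> + \<psi>) = T \<phi> + T \<psi>) \<and>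
     (\<forall>c. \<forall>\<phi>\<in>X. T (bc_scale c \<phi>) = bc_scale c (T \<phi>)) \<and>
     continuous_on X T \<and> bij_betw T X X"

definition wcomp ::
  "('a \<Rightarrow> 'k) \<Rightarrow> ('a \<Rightarrow> 'a) \<Rightarrow> ('a::topological_space \<Rightarrow>\<^sub>C 'k::real_normed_field) \<Rightarrow> ('a \<Rightarrow>\<^sub>C 'k)" where
  "wcomp w f \<phi> = Bcontfun (\<lambda>x. \<phi> (f x) * w x)"

lemma wcomp_apply:
  assumes "invertible_system f w"
  shows "wcomp w f \<phi> x = \<phi> (f x) * w x"
proof -
  have "continuous_on UNIV f"
    using assms by (simp add: invertible_system_def homeomorphism_def)
  then have 1: "(\<lambda>x. \<phi> (f x)) \<in> bcontfun"
    by (intro bcontfunI continuous_on_compose2[OF continuous_on_apply_bcontfun[of UNIV \<phi>]]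
        bounded_subset[OF bounded_apply_bcontfun[of \<phi>]]) auto
  have 2: "w \<in> bcontfun"
    using assms by (intro bcontfunI) (auto simp: invertible_system_def bounded_iff bdd_above_def)
  show ?thesis
    unfolding wcomp_def by (simp add: Bcontfun_inverse[OF bcontfun_mult[OF 1 2]])
qed

text \<open>
  Integers carry the discrete topology, so \<open>int \<Rightarrow>\<^sub>C 'k\<close> is the space of bounded two-sided
  sequences with the supremum norm.
\<close>

definition orbit_seqs ::
  "('a \<Rightarrow> 'a) \<Rightarrow> ('a::topological_space \<Rightarrow>\<^sub>C 'k::real_normed_field) set \<Rightarrow> 'a \<Rightarrow> (int \<Rightarrow>\<^sub>C 'k) set" where
  "orbit_seqs f X x = {s. \<exists>\<phi>\<in>X. \<forall>n. apply_bcontfun s n = \<phi> (ziter UNIV f n x)}"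

lift_definition unit_seq :: "int \<Rightarrow> (int \<Rightarrow>\<^sub>C 'k::real_normed_field)"
  is "\<lambda>n j. if j = n then 1 else 0"
  by (rule bcontfun_normI[where b = 1]) auto

lemma seq_cutoff:
  fixes s :: "int \<Rightarrow> 'k::real_normed_field"
  assumes "s \<in> bcontfun"
  shows "(\<lambda>n. if P n then s n else 0) \<in> bcontfun"
proof (rule bcontfunI)
  have "range (\<lambda>n. if P n then s n else 0) \<subseteq> insert 0 (range s)"
    by auto
  moreover have "bounded (insert 0 (range s))"
    using assms by (simp add: bcontfun_def)
  ultimately show "bounded (range (\<lambda>n. if P n then s n else 0))"
    by (rule bounded_subset[rotated])
qed simp

lift_definition proj_nonpos :: "(int \<Rightarrow>\<^sub>C 'k::real_normed_field) \<Rightarrow> (int \<Rightarrow>\<^sub>C 'k)"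
  is "\<lambda>s n. if n \<le> 0 then s n else 0"
  by (rule seq_cutoff)

lift_definition proj_pos :: "(int \<Rightarrow>\<^sub>C 'k::real_normed_field) \<Rightarrow> (int \<Rightarrow>\<^sub>C 'k)"
  is "\<lambda>s n. if 0 < n then s n else 0"
  by (rule seq_cutoff)

definition generating_set :: "'a::topological_space set \<Rightarrow> bool" where
  "generating_set W \<longleftrightarrow>
     compact (closure W) \<and> connected W \<and> interior W \<noteq> {} \<and> W \<subseteq> closure (interior W)"

text \<open>
  The cut-off functions \<open>\<rho>m\<close> and \<open>\<rho>p\<close> are continuous with supremum norm 1, so quantifying over
  \<open>bcontfun\<close> loses none. The final inclusion says that \<open>X\<close> contains every continuous function with
  compact support; such a function is automatically bounded.
\<close>

definition admissible_space ::
  "('a \<Rightarrow> 'a) \<Rightarrow> ('a \<Rightarrow> 'k) \<Rightarrow> 'a set \<Rightarrow> ('a::t2_space \<Rightarrow>\<^sub>C 'k::real_normed_field) set \<Rightarrow> bool" where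
  "admissible_space f w W X \<longleftrightarrow>
     generating_set W \<and>
     closed_subspace X \<and>
     invertible_operator_on X (wcomp w f) \<and>
     ((\<Union>k. ziter UNIV f k ` W) = UNIV \<and> disjoint_family (\<lambda>k. ziter UNIV f k ` W)) \<and>
     (\<exists>\<rho>m \<rho>p :: 'a \<Rightarrow>\<^sub>C 'k.
        (\<forall>\<phi>\<in>X. bc_mult \<rho>m \<phi> \<in> X \<and> bc_mult \<rho>p \<phi> \<in> X) \<and>
        norm \<rho>m = 1 \<and> norm \<rho>p = 1 \<and>
        supp \<rho>m = Omega_minus f W 0 \<and> supp \<rho>p = Omega_plus f W 0 \<and>
        (\<forall>x. \<rho>m x + \<rho>p x = 1)) \<and>
     (\<forall>x. closed (orbit_seqs f X x) \<and>
          (\<forall>n. unit_seq n \<in> orbit_seqs f X x) \<and>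
          proj_nonpos ` orbit_seqs f X x \<subseteq> orbit_seqs f X x \<and>
          proj_pos ` orbit_seqs f X x \<subseteq> orbit_seqs f X x) \<and>
     {\<phi>. compact (supp (apply_bcontfun \<phi>))} \<subseteq> X"

end

theory Submission
  imports Defs
begin

text \<open>
  Let \<open>T = C\<^bsub>w,f\<^esub>\<close>, so that \<open>T\<^sup>n \<psi> = (\<psi> \<circ> f\<^sup>n) w\<^bsup>[n]\<^esup>\<close>. Shadowing a pseudo-orbit with errors \<open>z j\<close>
  amounts to solving \<open>y (j + 1) = T (y j) + z j\<close> with \<open>y\<close> small whenever \<open>z\<close> is small.

  Each condition on the weights gives such a solution. Split \<open>z j\<close> into \<open>\<rho>\<^sub>- z j + \<rho>\<^sub>+ z j\<close>; push the
  first part forward by powers of \<open>T\<close> and the second part backward by powers of the inverse. Since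
  \<open>T\<^sup>k (\<rho>\<^sub>- \<psi>)\<close> lives on \<open>\<Omega>\<^sub>-\<^sup>k\<close> and \<open>T\<^bsup>-k\<^esup> (\<rho>\<^sub>+ \<psi>)\<close> on \<open>\<Omega>\<^sub>+\<^sup>k\<close>, condition (C) makes both series
  converge geometrically; (A) and (B) are the cases in which one part is everything
  (\<open>shadowing_from_splitting\<close>, \<open>shadowing_from_cutoffs\<close>).

  Conversely, bump functions at the points of an orbit reduce shadowing to scalar equations
  \<open>u n = w (f\<^sup>n x) u (n + 1) + v n\<close>, and one choice of \<open>v\<close> yields, with \<open>\<delta>\<close> independent of \<open>x\<close> and \<open>b\<close>,
  that \<open>\<delta>\<close> times the sum of \<open>\<bar>w\<^bsup>[n]\<^esup> x\<bar>\<close> over \<open>n < b\<close> is at most \<open>1 + \<bar>w\<^bsup>[b]\<^esup> x\<bar>\<close>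
  (\<open>shadowing_imp_sum_bound\<close>). A sequence that controls its own partial sums in this way grows
  geometrically, so for some \<open>N\<close> and every \<open>x\<close> the numbers \<open>\<bar>w\<^bsup>[n]\<^esup> x\<bar>\<close> are at least 2 for all \<open>n \<ge> N\<close> or
  for all \<open>n \<le> - N\<close> (\<open>growth_in_one_direction\<close>).

  This dichotomy is rigid. A long block of weights expands by 2 or contracts by 1/2 unless the point
  is near a turning point, and once expansion has set in it persists. As \<open>f\<close> is an isometry and \<open>w\<close> is
  uniformly continuous, nearby points have comparable weights along their entire orbits. Hence
  the points whose orbits meet an expanding block form an open and closed invariant set, and
  connectedness of \<open>W\<close> leaves only the empty set and the whole space. In the first case the weights
  contract everywhere, which is (A). In the second case compactness of the closure of \<open>W\<close> bounds the
  time at which expansion sets in (\<open>contraction_or_expansion_from_W\<close>). The same argument in reversed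
  time gives (B) or contraction in the past of \<open>W\<close>; if neither (A) nor (B) holds, what remains is
  (C) (\<open>trichotomy\<close>). Submultiplicativity of the sup norms then turns one value below 1 into a limit
  of roots below 1 (\<open>supnorm_root_limit\<close>).
\<close>

section \<open>Integer iterates and the weight cocycle\<close>

lemma ziter_0 [simp]: "ziter X T 0 x = x"
  by (simp add: ziter_def)

lemma ziter_in:
  assumes "bij_betw T X X" "x \<in> X"
  shows "ziter X T n x \<in> X"
proof -
  have "(T ^^ k) x \<in> X" for k
    using assms by (induction k) (auto simp: bij_betw_def)
  moreover have "(inv_into X T ^^ k) x \<in> X" for k
    using assms by (induction k) (auto simp: bij_betw_def inv_into_into)
  ultimately show ?thesis
    by (simp add: ziter_def)
qed

lemma ziter_step:
  assumes "bij_betw T X X" "x \<in> X"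
  shows "ziter X T (n + 1) x = T (ziter X T n x)"
proof (cases "0 \<le> n")
  case True
  then show ?thesis
    by (simp add: ziter_def nat_add_distrib)
next
  case False
  then obtain k where k: "n = - int (Suc k)"
    by (metis int_cases of_nat_0_le_iff)
  have "ziter X T (- int k) x \<in> T ` X"
    using ziter_in[OF assms] assms(1) by (auto simp: bij_betw_def)
  then have "T (inv_into X T (ziter X T (- int k) x)) = ziter X T (- int k) x"
    by (rule f_inv_into_f)
  moreover have "ziter X T n x = inv_into X T (ziter X T (- int k) x)"
    by (cases k) (simp_all add: k ziter_def nat_add_distrib)
  ultimately show ?thesis
    by (simp add: k)
qed

text \<open>
  A two-sided orbit is determined by its value at time 0. Group laws for iterates and the form of
  the orbits that shadow are both read off from this.
\<close>

lemma ziter_eqI: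
  assumes bij: "bij_betw T X X" and d: "\<And>j. d j \<in> X" and step: "\<And>j. d (j + 1) = T (d j)"
  shows "ziter X T j (d 0) = d j"
proof (induction j rule: int_induct[of _ 0])
  case (step1 i)
  then show ?case
    using ziter_step[OF bij d] step by simp
next
  case (step2 i)
  have "T (ziter X T (i - 1) (d 0)) = T (d (i - 1))"
    using step2 ziter_step[OF bij d, of "i - 1"] step[of "i - 1"] by simp
  then show ?case
    using bij ziter_in[OF bij d] d by (auto simp: bij_betw_def inj_on_def)
qed simp

lemma ziter_add:
  assumes "bij f"
  shows "ziter UNIV f (m + n) x = ziter UNIV f m (ziter UNIV f n x)"
proof -
  have "ziter UNIV f (j + 1 + n) x = f (ziter UNIV f (j + n) x)" for j
    using ziter_step[OF assms, of x "j + n"] by (simp add: add.commute add.left_commute)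
  then show ?thesis
    using ziter_eqI[OF assms, of "\<lambda>m. ziter UNIV f (m + n) x" m] by simp
qed

lemma ziter_1: "bij f \<Longrightarrow> ziter UNIV f 1 x = f x"
  using ziter_step[of f UNIV x 0] by simp

lemma dist_ziter:
  fixes f :: "'a::metric_space \<Rightarrow> 'a"
  assumes "bij f" and iso: "\<forall>x y. dist (f x) (f y) = dist x y"
  shows "dist (ziter UNIV f n x) (ziter UNIV f n y) = dist x y"
proof (induction n rule: int_induct[of _ 0])
  case (step1 i)
  then show ?case
    using iso by (simp add: ziter_step[OF assms(1)])
next
  case (step2 i)
  then show ?case
    using iso ziter_step[OF assms(1), of _ "i - 1"] by simp
qed simp

lemma wprod_0 [simp]: "wprod f w 0 x = 1"
  by (simp add: wprod_def)

lemma wprod_step: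
  assumes "\<forall>x. w x \<noteq> 0"
  shows "wprod f w (n + 1) x = w (ziter UNIV f n x) * wprod f w n x"
proof (cases "0 \<le> n")
  case True
  then show ?thesis
    by (simp add: wprod_def nat_add_distrib)
next
  case False
  then obtain k where k: "n = - int (Suc k)"
    by (metis int_cases of_nat_0_le_iff)
  have "wprod f w n x = 1 / w (ziter UNIV f n x) * wprod f w (- int k) x"
    by (cases k) (simp_all add: k wprod_def nat_add_distrib)
  then show ?thesis
    using assms by (simp add: k)
qed

lemma wprod_1: "(\<forall>x. w x \<noteq> 0) \<Longrightarrow> wprod f w 1 x = w x"
  using wprod_step[of w f 0 x] by simp

lemma wprod_nonzero:
  assumes "\<forall>x. w x \<noteq> 0"
  shows "wprod f w n x \<noteq> 0"
proof (induction n rule: int_induct[of _ 0])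
  case (step2 i)
  then show ?case
    using wprod_step[OF assms, where n = "i - 1"] by auto
qed (use assms wprod_step[OF assms] in auto)

lemma wprod_add:
  assumes "bij f" "\<forall>x. w x \<noteq> 0"
  shows "wprod f w (m + n) x = wprod f w m (ziter UNIV f n x) * wprod f w n x"
proof (induction m rule: int_induct[of _ 0])
  case (step1 i)
  have "wprod f w (i + 1 + n) x = w (ziter UNIV f (i + n) x) * wprod f w (i + n) x"
    using wprod_step[OF assms(2), where n = "i + n"] by (simp add: algebra_simps)
  then show ?case
    using step1 by (simp add: wprod_step[OF assms(2)] ziter_add[OF assms(1)])
next
  case (step2 i)
  have "w (ziter UNIV f (i - 1 + n) x) * wprod f w (i - 1 + n) x = wprod f w (i + n) x"
    using wprod_step[OF assms(2), where n = "i - 1 + n"] by (simp add: algebra_simps)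
  moreover have "wprod f w i (ziter UNIV f n x)
      = w (ziter UNIV f (i - 1 + n) x) * wprod f w (i - 1) (ziter UNIV f n x)"
    using wprod_step[OF assms(2), where n = "i - 1"] by (simp add: ziter_add[OF assms(1)])
  ultimately show ?case
    using step2 spec[OF assms(2), of "ziter UNIV f (i - 1 + n) x"] by (simp add: mult.assoc)
qed simp

section \<open>Isometric cocycles and their expansion\<close>

text \<open>
  An action of the integers by isometries together with a multiplicative cocycle of positive
  numbers; the instance of interest is \<open>c n = \<bar>w\<^bsup>[n]\<^esup>\<bar>\<close>. The axioms are
  invariant under reversal of time, so every one-sided result has a mirror image.
\<close>

locale isometric_cocycle =
  fixes \<phi> :: "int \<Rightarrow> 'a::metric_space \<Rightarrow> 'a" and c :: "int \<Rightarrow> 'a \<Rightarrow> real"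
  assumes flow_0: "\<phi> 0 x = x"
    and flow_add: "\<phi> (m + n) x = \<phi> m (\<phi> n x)"
    and flow_isometry: "dist (\<phi> n x) (\<phi> n y) = dist x y"
    and pos: "0 < c n x"
    and cocycle: "c (m + n) x = c m (\<phi> n x) * c n x"
    and bounded_step: "\<exists>B. \<forall>x. c 1 x \<le> B \<and> c (- 1) x \<le> B"
    and comparable_step: "1 < q \<Longrightarrow> \<exists>r>0. \<forall>x y. dist x y < r \<longrightarrow> c 1 x \<le> q * c 1 y"
begin

lemma flow_cancel [simp]: "\<phi> (- n) (\<phi> n x) = x" "\<phi> n (\<phi> (- n) x) = x"
  using flow_add[of "- n" n x] flow_add[of n "- n" x] by (simp_all add: flow_0)

lemma cocycle_0 [simp]: "c 0 x = 1"
  using cocycle[of 0 0 x] pos[of 0 x] by (simp add: flow_0)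

lemma cocycle_inverse: "c (- n) x = 1 / c n (\<phi> (- n) x)"
  using cocycle[of n "- n" x] pos[of n "\<phi> (- n) x"] by (simp add: field_simps)

lemma bounded: "\<exists>B>0. \<forall>x. c n x \<le> B"
proof -
  obtain B where B: "\<And>x. c 1 x \<le> B" "\<And>x. c (- 1) x \<le> B"
    using bounded_step by blast
  have B0: "0 < B"
    using B(1)[of undefined] pos[of 1 undefined] by linarith
  have mult: "\<exists>C>0. \<forall>x. c (m + n) x \<le> C"
    if "\<exists>C>0. \<forall>x. c m x \<le> C" "\<And>x. c n x \<le> B" for m n
  proof -
    obtain C where C: "0 < C" "\<And>x. c m x \<le> C"
      using \<open>\<exists>C>0. \<forall>x. c m x \<le> C\<close> by blast
    have "c (m + n) x \<le> C * B" for x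
      unfolding cocycle using C that(2) pos[of n x] less_imp_le[OF C(1)]
      by (intro mult_mono) (auto intro: less_imp_le)
    then show ?thesis
      using C(1) B0 by (intro exI[of _ "C * B"]) simp
  qed
  show ?thesis
  proof (induction n rule: int_induct[of _ 0])
    case base
    show ?case
      by (intro exI[of _ 1]) simp
  next
    case (step1 i)
    then show ?case
      using mult[of i 1] B(1) by simp
  next
    case (step2 i)
    then show ?case
      using mult[of i "- 1"] B(2) by simp
  qed
qed

text \<open>
  The isometric action preserves closeness of points, so a local comparison of one factor of a
  product of weights is a local comparison of every factor. The multiplicative form of uniform
  continuity used here passes to products and to inverses.
\<close>

lemma comparable:
  assumes "1 < q"
  shows "\<exists>r>0. \<forall>x y. dist x y < r \<longrightarrow> c n x \<le> q * c n y"
  using assms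
proof (induction n arbitrary: q rule: int_induct[of _ 0])
  case base
  then show ?case
    by (intro exI[of _ 1]) simp
next
  case (step1 i)
  have q: "1 < sqrt q"
    using step1.prems by simp
  obtain r s where r: "0 < r" "\<And>x y. dist x y < r \<Longrightarrow> c i x \<le> sqrt q * c i y"
    and s: "0 < s" "\<And>x y. dist x y < s \<Longrightarrow> c 1 x \<le> sqrt q * c 1 y"
    using step1.IH[OF q] comparable_step[OF q] by blast
  have "c (i + 1) x \<le> q * c (i + 1) y" if "dist x y < min r s" for x y
  proof -
    have "c (i + 1) x \<le> (sqrt q * c i (\<phi> 1 y)) * (sqrt q * c 1 y)"
      unfolding cocycle using that flow_isometry[of 1 x y] pos less_imp_le[OF pos] q
      by (intro mult_mono r(2) s(2)) auto
    also have "\<dots> = q * c (i + 1) y"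
      using step1.prems by (simp add: cocycle mult.left_commute)
    finally show ?thesis .
  qed
  then show ?case
    using r(1) s(1) by (intro exI[of _ "min r s"]) simp
next
  case (step2 i)
  have q: "1 < sqrt q"
    using step2.prems by simp
  obtain r s where r: "0 < r" "\<And>x y. dist x y < r \<Longrightarrow> c i x \<le> sqrt q * c i y"
    and s: "0 < s" "\<And>x y. dist x y < s \<Longrightarrow> c 1 x \<le> sqrt q * c 1 y"
    using step2.IH[OF q] comparable_step[OF q] by blast
  have "c (i - 1) x \<le> q * c (i - 1) y" if "dist x y < min r s" for x y
  proof -
    have inv: "c (- 1) x \<le> sqrt q * c (- 1) y"
      using s(2)[of "\<phi> (- 1) y" "\<phi> (- 1) x"] that flow_isometry[of "- 1" y x]
        pos[of 1 "\<phi> (- 1) y"] pos[of 1 "\<phi> (- 1) x"]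
      by (simp add: cocycle_inverse[of 1] dist_commute field_simps)
    have "c (i + - 1) x \<le> (sqrt q * c i (\<phi> (- 1) y)) * (sqrt q * c (- 1) y)"
      unfolding cocycle using that flow_isometry[of "- 1" x y] pos less_imp_le[OF pos] q
      by (intro mult_mono r(2) inv) auto
    also have "\<dots> = q * c (i + - 1) y"
      using step2.prems cocycle[of i "- 1" y] by (simp add: mult.left_commute)
    finally show ?thesis by simp
  qed
  then show ?case
    using r(1) s(1) by (intro exI[of _ "min r s"]) simp
qed

text \<open>
  Bounds found on the images of \<open>W\<close> extend to the closed sets \<open>\<Omega>\<^sub>\<plusminus>\<^sup>n\<close>.
\<close>

lemma le_on_closure:
  assumes x: "x \<in> closure S" and S: "\<And>y. y \<in> S \<Longrightarrow> c n y \<le> C"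
  shows "c n x \<le> C"
proof (rule ccontr)
  assume "\<not> c n x \<le> C"
  obtain y0 where "y0 \<in> S"
    using x by fastforce
  then have C: "0 < C"
    using S[of y0] pos[of n y0] by linarith
  define q where "q = (c n x / C + 1) / 2"
  have q: "1 < q" "q * C < c n x"
    using C \<open>\<not> c n x \<le> C\<close> by (simp_all add: q_def field_simps)
  obtain r where r: "0 < r" "\<And>y. dist x y < r \<Longrightarrow> c n x \<le> q * c n y"
    using comparable[OF q(1)] by blast
  obtain y where y: "y \<in> S" "dist x y < r"
    using x r(1) by (metis closure_approachable dist_commute)
  have "c n x \<le> q * C"
    using r(2)[OF y(2)] mult_left_mono[OF S[OF y(1)], of q] q(1) by linarith
  then show False
    using q(2) by linarith
qed

lemma time_reversal: "isometric_cocycle (\<lambda>n. \<phi> (- n)) (\<lambda>n. c (- n))"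
proof
  fix q :: real assume "1 < q"
  then show "\<exists>r>0. \<forall>x y. dist x y < r \<longrightarrow> c (- 1) x \<le> q * c (- 1) y"
    by (rule comparable)
next
  fix m n x
  show "c (- (m + n)) x = c (- m) (\<phi> (- n) x) * c (- n) x"
    using cocycle[of "- m" "- n" x] by (simp add: algebra_simps)
  show "\<phi> (- (m + n)) x = \<phi> (- m) (\<phi> (- n) x)"
    using flow_add[of "- m" "- n" x] by (simp add: algebra_simps)
next
  show "\<exists>B. \<forall>x. c (- 1) x \<le> B \<and> c (- (- 1)) x \<le> B"
    using bounded_step by (simp add: conj_commute)
qed (simp_all add: flow_0 flow_isometry pos)

text \<open>
  A discrete form of convexity. Let \<open>s k\<close> be the sum of \<open>c l x\<close> over \<open>\<bar>l\<bar> \<le> k\<close>. The hypothesis bounds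
  \<open>\<theta> * s k\<close> by the two boundary terms, which are the increment of \<open>s\<close>, so
  \<open>s\<close> grows geometrically from \<open>s 0 = 1\<close> at a rate that depends on \<open>\<delta>\<close> alone. Hence the
  two boundary terms of a long interval around 0 cannot both be small.
\<close>

lemma growth_in_one_direction:
  assumes \<delta>: "0 < \<delta>" and sum: "\<And>x b. \<delta> * (\<Sum>n<b. c (int n) x) \<le> 1 + c (int b) x"
  shows "\<exists>N\<ge>1. \<forall>x. \<forall>a\<ge>N. \<forall>b\<ge>N. 2 \<le> c (- int a) x \<or> 2 \<le> c (int b) x"
proof -
  define \<theta> where "\<theta> = \<delta> / (1 + \<delta>)"
  have \<theta>: "0 < \<theta>" "\<theta> < 1"
    using \<delta> by (simp_all add: \<theta>_def)
  have interval: "\<theta> * (\<Sum>l\<in>{- int a..int b}. c l x) \<le> c (- int a) x + c (int b) x" for a b x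
  proof -
    have "(\<Sum>l\<in>{- int a..<int b}. c l x) = (\<Sum>n<a + b. c (int n - int a) x)"
      by (rule sum.reindex_bij_witness[of _ "\<lambda>n. int n - int a" "\<lambda>l. nat (l + int a)"]) auto
    also have "\<dots> = (\<Sum>n<a + b. c (int n) (\<phi> (- int a) x)) * c (- int a) x"
      using cocycle[of "int _" "- int a" x] by (simp add: sum_distrib_right)
    finally have "\<delta> * (\<Sum>l\<in>{- int a..<int b}. c l x)
        = (\<delta> * (\<Sum>n<a + b. c (int n) (\<phi> (- int a) x))) * c (- int a) x"
      by simp
    also have "\<dots> \<le> (1 + c (int (a + b)) (\<phi> (- int a) x)) * c (- int a) x"
      using sum less_imp_le[OF pos] by (intro mult_right_mono)
    also have "\<dots> = c (- int a) x + c (int b) x"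
      using cocycle[of "int (a + b)" "- int a" x] by (simp add: algebra_simps)
    finally have "\<delta> * (\<Sum>l\<in>{- int a..<int b}. c l x) \<le> c (- int a) x + c (int b) x" .
    moreover have "{- int a..int b} = insert (int b) {- int a..<int b}"
      by auto
    then have "(\<Sum>l\<in>{- int a..int b}. c l x) = (\<Sum>l\<in>{- int a..<int b}. c l x) + c (int b) x"
      by (simp add: add.commute)
    moreover have "\<delta> * c (int b) x \<le> \<delta> * (c (- int a) x + c (int b) x)"
      using \<delta> pos[of "- int a" x] by simp
    ultimately have "\<delta> * (\<Sum>l\<in>{- int a..int b}. c l x)
        \<le> (1 + \<delta>) * (c (- int a) x + c (int b) x)"
      by (simp add: algebra_simps)
    then show ?thesis
      using \<delta> by (simp add: \<theta>_def field_simps)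
  qed
  have geometric: "1 \<le> (1 - \<theta>) ^ k * (\<Sum>l\<in>{- int k..int k}. c l x)" for k x
  proof (induction k)
    case (Suc k)
    have "{- int (Suc k)..int (Suc k)} = insert (int (Suc k)) (insert (- int (Suc k)) {- int k..int k})"
      by auto
    then have "(\<Sum>l\<in>{- int (Suc k)..int (Suc k)}. c l x)
        = c (int (Suc k)) x + (c (- int (Suc k)) x + (\<Sum>l\<in>{- int k..int k}. c l x))"
      by (simp del: of_nat_Suc)
    then have "(\<Sum>l\<in>{- int k..int k}. c l x) \<le> (1 - \<theta>) * (\<Sum>l\<in>{- int (Suc k)..int (Suc k)}. c l x)"
      using interval[where a = "Suc k" and b = "Suc k" and x = x] by (simp add: algebra_simps)
    then have "(1 - \<theta>) ^ k * (\<Sum>l\<in>{- int k..int k}. c l x)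
        \<le> (1 - \<theta>) ^ k * ((1 - \<theta>) * (\<Sum>l\<in>{- int (Suc k)..int (Suc k)}. c l x))"
      using \<theta> by (intro mult_left_mono) auto
    then show ?case
      using Suc by (simp add: algebra_simps)
  qed simp
  obtain N0 where N0: "(1 - \<theta>) ^ N0 < \<theta> / 4"
    using real_arch_pow_inv[of "\<theta> / 4" "1 - \<theta>"] \<theta> by auto
  define N where "N = Suc N0"
  have N: "(1 - \<theta>) ^ N < \<theta> / 4"
  proof -
    have "(1 - \<theta>) ^ N \<le> (1 - \<theta>) ^ N0"
      using \<theta> by (intro power_decreasing) (auto simp: N_def)
    then show ?thesis
      using N0 by linarith
  qed
  have "2 \<le> c (- int a) x \<or> 2 \<le> c (int b) x" if "N \<le> a" "N \<le> b" for a b x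
  proof (rule ccontr)
    assume "\<not> ?thesis"
    then have "\<theta> * (\<Sum>l\<in>{- int a..int b}. c l x) < 4"
      using interval[where a = a and b = b and x = x] by linarith
    moreover have "(\<Sum>l\<in>{- int N..int N}. c l x) \<le> (\<Sum>l\<in>{- int a..int b}. c l x)"
      using that less_imp_le[OF pos] by (intro sum_mono2) auto
    ultimately have small: "\<theta> * (\<Sum>l\<in>{- int N..int N}. c l x) < 4"
      using \<theta> by (smt (verit) mult_left_mono)
    have "4 * 1 \<le> 4 * ((1 - \<theta>) ^ N * (\<Sum>l\<in>{- int N..int N}. c l x))"
      using geometric[where k = N and x = x] by simp
    also have "\<dots> \<le> \<theta> * (\<Sum>l\<in>{- int N..int N}. c l x)"
    proof -
      have "0 \<le> (\<Sum>l\<in>{- int N..int N}. c l x)"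
        using less_imp_le[OF pos] by (simp add: sum_nonneg)
      then have "(4 * (1 - \<theta>) ^ N) * (\<Sum>l\<in>{- int N..int N}. c l x)
          \<le> \<theta> * (\<Sum>l\<in>{- int N..int N}. c l x)"
        using N by (intro mult_right_mono) auto
      then show ?thesis
        by (simp add: mult.assoc)
    qed
    finally show False
      using small by simp
  qed
  then show ?thesis
    by (intro exI[of _ N]) (auto simp: N_def)
qed

text \<open>
  The alternative is decided by the set \<open>E\<close> of points whose orbit meets an
  expanding block of length \<open>N\<close>: elsewhere all blocks contract by at least \<open>1/2\<close>, so the gap between
  \<open>1/2\<close> and \<open>2\<close> makes \<open>E\<close> open and closed. As \<open>E\<close> is invariant and \<open>W\<close> is connected and sweeps out the
  space, \<open>E\<close> is empty or everything. After one expanding block all later long blocks expand,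
  and compactness bounds the waiting time.
\<close>

lemma contraction_or_expansion_from_W:
  assumes N: "1 \<le> N"
    and D: "\<And>x a b. N \<le> a \<Longrightarrow> N \<le> b \<Longrightarrow> 2 \<le> c (- int a) x \<or> 2 \<le> c (int b) x"
    and W: "compact (closure W)" "connected W" "(\<Union>k. \<phi> k ` W) = UNIV"
  shows "(\<exists>n\<ge>1. \<forall>x. c (int n) x \<le> 1 / 2)
    \<or> (\<exists>n\<ge>1. \<forall>x\<in>W. \<forall>k. c (int n) (\<phi> (int k) x) \<ge> 2)"
proof -
  \<comment> \<open>Outside \<open>E\<close> the second alternative of \<open>D\<close> fails everywhere on the orbit, so each block of
    length \<open>N\<close>, seen from its right end, satisfies the first.\<close>
  define E where "E = {x. \<exists>n. 2 \<le> c (int N) (\<phi> n x)}"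
  have contracting: "c (int N) (\<phi> n x) \<le> 1 / 2" if "x \<notin> E" for x n
  proof -
    have "\<not> 2 \<le> c (int N) (\<phi> (n + int N) x)"
      using that by (auto simp: E_def)
    then have "2 \<le> c (- int N) (\<phi> (n + int N) x)"
      using D[of N N "\<phi> (n + int N) x"] by blast
    moreover have "\<phi> (- int N) (\<phi> (n + int N) x) = \<phi> n x"
      by (simp flip: flow_add)
    ultimately show ?thesis
      using pos[of "int N" "\<phi> n x"] by (simp add: cocycle_inverse[of "int N"] field_simps)
  qed
  obtain r where r: "0 < r" "\<And>x y. dist x y < r \<Longrightarrow> c (int N) x \<le> 2 * c (int N) y"
    using comparable[of 2 "int N"] by auto
  have nearby: "1 \<le> c (int N) (\<phi> n y)" if "dist x y < r" "2 \<le> c (int N) (\<phi> n x)" for x y n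
    using r(2)[of "\<phi> n x" "\<phi> n y"] that by (simp add: flow_isometry)
  have spread: "y \<in> E" if "x \<in> E" "dist x y < r" for x y
  proof (rule ccontr)
    assume "y \<notin> E"
    obtain n where "2 \<le> c (int N) (\<phi> n x)"
      using \<open>x \<in> E\<close> by (auto simp: E_def)
    then show False
      using nearby[OF that(2)] contracting[OF \<open>y \<notin> E\<close>, of n] by fastforce
  qed
  have "open E"
    using spread r(1) by (auto simp: open_dist dist_commute)
  moreover have "open (- E)"
    using spread r(1) unfolding open_dist by (metis ComplD ComplI)
  moreover have "W \<subseteq> E \<union> - E" "E \<inter> - E \<inter> W = {}"
    by auto
  ultimately have clopen: "E \<inter> W = {} \<or> - E \<inter> W = {}"
    using connectedD[OF W(2)] by blast
  have invariant: "\<phi> k x \<in> E \<longleftrightarrow> x \<in> E" for k x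
  proof
    assume "\<phi> k x \<in> E"
    then obtain n where "2 \<le> c (int N) (\<phi> (n + k) x)"
      by (auto simp: E_def flow_add)
    then show "x \<in> E"
      unfolding E_def by blast
  next
    assume "x \<in> E"
    then obtain n where "2 \<le> c (int N) (\<phi> (n - k + k) x)"
      by (auto simp: E_def)
    then show "\<phi> k x \<in> E"
      unfolding E_def flow_add by blast
  qed
  have sweep: "\<exists>k. \<exists>y\<in>W. x = \<phi> k y" for x
  proof -
    have "x \<in> (\<Union>k. \<phi> k ` W)"
      unfolding W(3) by simp
    then show ?thesis
      by auto
  qed
  have "x \<in> E \<longleftrightarrow> E \<inter> W \<noteq> {}" for x
    using sweep[of x] invariant clopen by (metis Compl_iff disjoint_iff)
  then have "E = {} \<or> E = UNIV"
    by blast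
  then show ?thesis
  proof
    assume "E = {}"
    then have "c (int N) x \<le> 1 / 2" for x
      using contracting[of x 0] by (simp add: flow_0)
    then show ?thesis
      using N by blast
  next
    assume E: "E = UNIV"
    then have "\<forall>x. \<exists>n. 2 \<le> c (int N) (\<phi> n x)"
      by (auto simp: E_def)
    then obtain t where t: "\<And>x. 2 \<le> c (int N) (\<phi> (t x) x)"
      by metis
    have "closure W \<subseteq> (\<Union>x\<in>closure W. ball x r)"
      using r(1) by auto
    then obtain F where F: "finite F" "closure W \<subseteq> (\<Union>x\<in>F. ball x r)"
      using compactE_image[OF W(1), of "closure W" "\<lambda>x. ball x r"] by (metis open_ball)
    obtain t0 where t0: "\<And>x. x \<in> F \<Longrightarrow> t x \<le> t0"
      using bdd_above.unfold[of "t ` F"] F(1) by auto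
    define n0 where "n0 = nat (t0 + 2 * int N)"
    have expanding: "2 \<le> c (int N) (\<phi> j y)" if "y \<in> W" "int n0 \<le> j" for y j
    proof -
      obtain x where x: "x \<in> F" "dist x y < r"
        using F(2) closure_subset[of W] \<open>y \<in> W\<close> by fastforce
      have block: "1 \<le> c (int N) (\<phi> (t x) y)"
        using nearby[OF x(2) t] .
      \<comment> \<open>A factor at least 1 over a past block rules out contraction, hence all future blocks of
        length at least \<open>N\<close> expand; they are the past blocks of later points.\<close>
      define i where "i = t x + int N"
      have "\<phi> (- int N) (\<phi> i y) = \<phi> (t x) y"
        by (simp add: i_def flip: flow_add)
      then have "c (- int N) (\<phi> i y) \<le> 1"
        using block by (simp add: cocycle_inverse[of "int N"])
      then have future: "2 \<le> c (int b) (\<phi> i y)" if "N \<le> b" for b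
        using D[of N b "\<phi> i y"] that by fastforce
      define b where "b = nat (j - i)"
      have "t0 + 2 * int N \<le> j"
        using that(2) unfolding n0_def by linarith
      then have b: "N \<le> b" "int b = j - i"
        using t0[OF x(1)] unfolding b_def i_def by linarith+
      have "\<phi> (- int b) (\<phi> j y) = \<phi> i y"
        by (simp add: b(2) flip: flow_add)
      then have "c (- int b) (\<phi> j y) \<le> 1 / 2"
        using future[OF b(1)] by (simp add: cocycle_inverse[of "int b"] field_simps)
      then show ?thesis
        using D[of b N "\<phi> j y"] b(1) by fastforce
    qed
    have growth: "2 ^ q \<le> c (int (q * N)) (\<phi> j y)" if "y \<in> W" "int n0 \<le> j" for q y j
    proof (induction q)
      case (Suc q)
      have "c (int (Suc q * N)) (\<phi> j y) = c (int N) (\<phi> (int (q * N) + j) y) * c (int (q * N)) (\<phi> j y)"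
        using cocycle[of "int N" "int (q * N)" "\<phi> j y"] by (simp add: flow_add)
      moreover have "2 \<le> c (int N) (\<phi> (int (q * N) + j) y)"
        using that by (intro expanding) (auto intro: add_increasing)
      ultimately show ?case
        using Suc by (simp add: mult_mono)
    qed simp
    \<comment> \<open>Up to time \<open>n0\<close> the cocycle can decrease, but by a factor of at most \<open>B\<close>, which \<open>q\<close> expanding
      blocks make up for.\<close>
    obtain B where B: "0 < B" "\<And>x. c (- int n0) x \<le> B"
      using bounded by blast
    obtain q0 where q0: "2 * B < 2 ^ q0"
      using real_arch_pow[of 2 "2 * B"] by auto
    define q where "q = Suc q0"
    have q: "2 * B \<le> 2 ^ q"
      using q0 B by (simp add: q_def)
    have "2 \<le> c (int (q * N + n0)) (\<phi> (int k) y)" if "y \<in> W" for y k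
    proof -
      have lower: "1 / B \<le> c (int n0) (\<phi> (int k) y)"
        using B(2)[of "\<phi> (int n0) (\<phi> (int k) y)"] B(1) pos[of "int n0" "\<phi> (int k) y"]
        by (simp add: cocycle_inverse[of "int n0"] field_simps)
      have "2 \<le> 2 ^ q * (1 / B)"
        using q B(1) by (simp add: field_simps)
      also have "\<dots> \<le> c (int (q * N)) (\<phi> (int n0 + int k) y) * c (int n0) (\<phi> (int k) y)"
        using growth[OF that, of "int n0 + int k" q] lower B(1) less_imp_le[OF pos]
        by (intro mult_mono) auto
      also have "\<dots> = c (int (q * N + n0)) (\<phi> (int k) y)"
        using cocycle[of "int (q * N)" "int n0" "\<phi> (int k) y"] by (simp add: flow_add)
      finally show ?thesis .
    qed
    then show ?thesis
      using N by (intro disjI2 exI[of _ "q * N + n0"]) (auto simp: q_def)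
  qed
qed

text \<open>
  The previous lemma and its mirror image each offer two outcomes. If neither offers a uniform
  contraction, the weights expand forward and contract backward from \<open>W\<close>, which is the third case.
\<close>

lemma trichotomy:
  assumes \<delta>: "0 < \<delta>" and sum: "\<And>x b. \<delta> * (\<Sum>n<b. c (int n) x) \<le> 1 + c (int b) x"
    and W: "compact (closure W)" "connected W" "(\<Union>k. \<phi> k ` W) = UNIV"
  shows "(\<exists>n\<ge>1. \<forall>x. c (int n) x \<le> 1 / 2)
    \<or> (\<exists>n\<ge>1. \<forall>x. c (- int n) x \<le> 1 / 2)
    \<or> (\<exists>n\<ge>1. \<forall>x\<in>W. \<forall>k\<ge>n. c (int n) (\<phi> (- int k) x) \<le> 1 / 2)
      \<and> (\<exists>n\<ge>1. \<forall>x\<in>W. \<forall>k\<ge>n. c (- int n) (\<phi> (int k) x) \<le> 1 / 2)"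
proof -
  interpret rev: isometric_cocycle "\<lambda>n. \<phi> (- n)" "\<lambda>n. c (- n)"
    by (rule time_reversal)
  obtain N where N: "1 \<le> N"
    "\<And>x a b. N \<le> a \<Longrightarrow> N \<le> b \<Longrightarrow> 2 \<le> c (- int a) x \<or> 2 \<le> c (int b) x"
    using growth_in_one_direction[OF \<delta> sum] by blast
  have W': "(\<Union>k. \<phi> (- k) ` W) = UNIV"
  proof (rule UNIV_eq_I[symmetric])
    fix x
    have "x \<in> (\<Union>k. \<phi> k ` W)"
      unfolding W(3) by simp
    then obtain k where "x \<in> \<phi> k ` W"
      by auto
    then show "x \<in> (\<Union>k. \<phi> (- k) ` W)"
      by (intro UN_I[of "- k"]) auto
  qed
  have forward: "\<exists>n\<ge>1. \<forall>x\<in>W. \<forall>k\<ge>n. c (- int n) (\<phi> (int k) x) \<le> 1 / 2"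
    if expansion: "\<exists>n\<ge>1. \<forall>x\<in>W. \<forall>k. c (int n) (\<phi> (int k) x) \<ge> 2"
  proof -
    obtain n where n: "1 \<le> n" "\<And>x k. x \<in> W \<Longrightarrow> c (int n) (\<phi> (int k) x) \<ge> 2"
      using expansion by blast
    have "c (- int n) (\<phi> (int k) x) \<le> 1 / 2" if "x \<in> W" "n \<le> k" for x k
    proof -
      have "\<phi> (- int n) (\<phi> (int k) x) = \<phi> (int (k - n)) x"
        using that by (simp add: of_nat_diff flip: flow_add)
      then show ?thesis
        using n(2)[OF that(1), of "k - n"] by (simp add: cocycle_inverse[of "int n"] field_simps)
    qed
    then show ?thesis
      using n(1) by blast
  qed
  have backward: "\<exists>n\<ge>1. \<forall>x\<in>W. \<forall>k\<ge>n. c (int n) (\<phi> (- int k) x) \<le> 1 / 2"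
    if expansion: "\<exists>n\<ge>1. \<forall>x\<in>W. \<forall>k. c (- int n) (\<phi> (- int k) x) \<ge> 2"
  proof -
    obtain n where n: "1 \<le> n" "\<And>x k. x \<in> W \<Longrightarrow> c (- int n) (\<phi> (- int k) x) \<ge> 2"
      using expansion by blast
    have "c (int n) (\<phi> (- int k) x) \<le> 1 / 2" if "x \<in> W" "n \<le> k" for x k
    proof -
      have "\<phi> (int n) (\<phi> (- int k) x) = \<phi> (- int (k - n)) x"
        using that by (simp add: of_nat_diff flip: flow_add)
      then show ?thesis
        using n(2)[OF that(1), of "k - n"] cocycle_inverse[of "- int n"] by (simp add: field_simps)
    qed
    then show ?thesis
      using n(1) by blast
  qed
  have "2 \<le> c (- (- int a)) x \<or> 2 \<le> c (- int b) x" if "N \<le> a" "N \<le> b" for x a b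
    using N(2)[OF that(2) that(1), of x] by auto
  from rev.contraction_or_expansion_from_W[OF N(1) this W(1,2) W']
    contraction_or_expansion_from_W[OF N W] forward backward
  show ?thesis
    by blast
qed

end

section \<open>Suprema of submultiplicative families\<close>

text \<open>
  Fekete's argument: with \<open>r\<close> the \<open>m\<close>-th root of \<open>a m\<close>, splitting \<open>n\<close> into blocks of length \<open>m\<close>
  gives \<open>a n \<le> C * r ^ n\<close>, so the roots converge to their infimum.
\<close>

lemma submultiplicative_root_limit:
  fixes a :: "nat \<Rightarrow> real"
  assumes pos: "\<And>n. 0 < a n" and submult: "\<And>m n. a (m + n) \<le> a m * a n"
    and small: "1 \<le> n0" "a n0 < 1"
  shows "\<exists>L<1. (\<lambda>n. root n (a n)) \<longlonglongrightarrow> L"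
proof -
  define L where "L = (INF n\<in>{1..}. root n (a n))"
  have bdd: "bdd_below ((\<lambda>n. root n (a n)) ` {1..})"
    using less_imp_le[OF pos] by (intro bdd_belowI[of _ 0]) (auto intro: real_root_ge_zero)
  have below: "L \<le> root n (a n)" if "1 \<le> n" for n
    unfolding L_def using that bdd by (intro cINF_lower) auto
  have "L < 1"
    using below[OF small(1)] small pos[of n0] real_root_lt_1_iff[of n0 "a n0"] by linarith
  moreover have "(\<lambda>n. root n (a n)) \<longlonglongrightarrow> L"
  proof (rule order_tendstoI)
    fix l assume "l < L"
    then have "l < root n (a n)" if "1 \<le> n" for n
      using below[OF that] by linarith
    then show "\<forall>\<^sub>F n in sequentially. l < root n (a n)"
      by (auto simp: eventually_sequentially)
  next
    fix u assume "L < u"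
    then obtain m where m: "1 \<le> m" "root m (a m) < u"
      unfolding L_def using cINF_less_iff[OF _ bdd] by auto
    define r where "r = root m (a m)"
    have r: "0 < r" "r ^ m = a m"
      using m(1) pos[of m] by (simp_all add: r_def)
    define C where "C = (\<Sum>s<m. a s / r ^ s)"
    have C: "0 < C"
      unfolding C_def using m(1) pos r(1) by (intro sum_pos) (auto simp: lessThan_empty_iff)
    have blocks: "a (q * m + s) \<le> a m ^ q * a s" for q s
    proof (induction q)
      case (Suc q)
      have "a (Suc q * m + s) \<le> a m * a (q * m + s)"
        using submult[of m "q * m + s"] by (simp add: add.assoc)
      also have "\<dots> \<le> a m * (a m ^ q * a s)"
        using Suc less_imp_le[OF pos[of m]] by (rule mult_left_mono)
      finally show ?case
        by (simp add: mult.assoc)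
    qed simp
    have upper: "a n \<le> C * r ^ n" for n
    proof -
      define q s where "q = n div m" and "s = n mod m"
      have n: "n = q * m + s" and s: "s < m"
        using m(1) by (simp_all add: q_def s_def)
      have "a s / r ^ s \<le> C"
        unfolding C_def using s less_imp_le[OF pos] r(1) by (intro member_le_sum) auto
      then have "a s \<le> C * r ^ s"
        using r(1) by (simp add: divide_le_eq)
      then have "a m ^ q * a s \<le> a m ^ q * (C * r ^ s)"
        using less_imp_le[OF pos[of m]] by (intro mult_left_mono) auto
      also have "\<dots> = C * r ^ n"
        by (simp add: n power_add power_mult mult.commute flip: r(2))
      finally show ?thesis
        using blocks[of q s] n by simp
    qed
    have "(\<lambda>n. root n C * r) \<longlonglongrightarrow> 1 * r"
      using C by (intro tendsto_mult LIMSEQ_root_const tendsto_const)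
    then have eventually_less: "\<forall>\<^sub>F n in sequentially. root n C * r < u"
      using m(2) by (intro order_tendstoD(2)[where y = "1 * r"]) (auto simp: r_def)
    have compare: "root n (a n) \<le> root n C * r" if "1 \<le> n" for n
    proof -
      have "root n (a n) \<le> root n (C * r ^ n)"
        using upper that by (simp add: real_root_le_iff)
      also have "\<dots> = root n C * r"
        using that r(1) by (simp add: real_root_mult real_root_power_cancel)
      finally show ?thesis .
    qed
    show "\<forall>\<^sub>F n in sequentially. root n (a n) < u"
      using eventually_less eventually_ge_at_top[of 1]
      by eventually_elim (use compare le_less_trans in blast)
  qed
  ultimately show ?thesis
    by blast
qed

lemma norm_le_supnorm_on:
  assumes "x \<in> B" "\<And>x. norm (\<psi> x) \<le> C"
  shows "norm (\<psi> x) \<le> supnorm_on B \<psi>"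
proof -
  have "bdd_above ((\<lambda>x. norm (\<psi> x)) ` B)"
    using assms(2) by (intro bdd_aboveI[of _ C]) auto
  then show ?thesis
    using assms(1) by (auto simp: supnorm_on_def intro: cSUP_upper)
qed

lemma supnorm_on_le:
  assumes "B \<noteq> {}" "\<And>x. x \<in> B \<Longrightarrow> norm (\<psi> x) \<le> C"
  shows "supnorm_on B \<psi> \<le> C"
  using assms by (auto simp: supnorm_on_def intro: cSUP_least)

lemma supnorm_on_nonneg:
  assumes "\<And>x. norm (\<psi> x) \<le> C"
  shows "0 \<le> supnorm_on B \<psi>"
proof (cases "B = {}")
  case False
  then obtain x where "x \<in> B"
    by blast
  then show ?thesis
    using norm_le_supnorm_on[of x B \<psi>, OF _ assms] norm_ge_zero[of "\<psi> x"] by linarith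
qed (simp add: supnorm_on_def)

text \<open>
  The shift hypothesis says that \<open>B\<close> is adapted to the cocycle: a product of length \<open>m + n\<close> starting
  in \<open>B (m + n)\<close> splits into a product of length \<open>n\<close> starting in \<open>B n\<close> and one of length \<open>m\<close>
  starting in \<open>B m\<close>. This makes the suprema submultiplicative, so that a single value below 1
  decides the limit.
\<close>

lemma supnorm_root_limit:
  fixes d :: "nat \<Rightarrow> 'a \<Rightarrow> 'k::real_normed_field"
  assumes nonempty: "\<And>n. B n \<noteq> {}"
    and shift: "\<And>m n x. x \<in> B (m + n) \<Longrightarrow> x \<in> B n \<and> g n x \<in> B m"
    and cocycle: "\<And>m n x. d (m + n) x = d m (g n x) * d n x"
    and nonzero: "\<And>n x. d n x \<noteq> 0"
    and bounded: "\<And>n. \<exists>C. \<forall>x. norm (d n x) \<le> C"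
    and small: "1 \<le> n" "\<And>x. x \<in> B n \<Longrightarrow> norm (d n x) \<le> 1 / 2"
  shows "\<exists>L<1. (\<lambda>n. root n (supnorm_on (B n) (d n))) \<longlonglongrightarrow> L"
proof (rule submultiplicative_root_limit)
  have upper: "norm (d n x) \<le> supnorm_on (B n) (d n)" if "x \<in> B n" for n x
    using norm_le_supnorm_on[OF that] bounded[of n] by metis
  show "0 < supnorm_on (B n) (d n)" for n
  proof -
    obtain x where "x \<in> B n"
      using nonempty[of n] by blast
    then show ?thesis
      using upper[of x n] nonzero[of n x] zero_less_norm_iff[of "d n x"] by linarith
  qed
  show "supnorm_on (B (m + n)) (d (m + n)) \<le> supnorm_on (B m) (d m) * supnorm_on (B n) (d n)" for m n
  proof (rule supnorm_on_le[OF nonempty])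
    fix x assume x: "x \<in> B (m + n)"
    have "norm (d m (g n x)) * norm (d n x) \<le> supnorm_on (B m) (d m) * supnorm_on (B n) (d n)"
      using shift[OF x] upper by (intro mult_mono) (auto intro: order_trans[OF norm_ge_zero])
    then show "norm (d (m + n) x) \<le> supnorm_on (B m) (d m) * supnorm_on (B n) (d n)"
      by (simp add: cocycle norm_mult)
  qed
  show "supnorm_on (B n) (d n) < 1"
    using supnorm_on_le[OF nonempty, of n "d n" "1 / 2"] small(2) by simp
qed (fact small(1))

section \<open>Shadowing from a splitting\<close>

lemma suminf_mem:
  fixes X :: "'b::real_normed_vector set"
  assumes "closed X" "subspace X" "\<And>k. u k \<in> X" "summable u"
  shows "suminf u \<in> X"
proof (rule closed_sequentially[OF assms(1)])
  show "(\<lambda>n. \<Sum>k<n. u k) \<longlonglongrightarrow> suminf u"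
    using assms(4) by (rule summable_LIMSEQ)
  show "(\<Sum>k<n. u k) \<in> X" for n
    using assms(2,3) by (intro subspace_sum) auto
qed

text \<open>
  If \<open>z j\<close> are the errors of a pseudo-orbit, subtracting a bounded solution of
  \<open>y (j + 1) = T (y j) + z j\<close> leaves a genuine orbit. The errors split by \<open>P\<close> are carried forward
  from the past and those split by \<open>Q\<close> are carried backward from the future, and
  both series converge.
\<close>

lemma shadowing_from_splitting:
  fixes T :: "'b::banach \<Rightarrow> 'b"
  assumes T: "bounded_linear T" "bij_betw T X X" and X: "closed X" "subspace X"
    and split: "\<And>z. z \<in> X \<Longrightarrow> P z \<in> X" "\<And>z. z \<in> X \<Longrightarrow> Q z \<in> X" "\<And>z. z \<in> X \<Longrightarrow> P z + Q z = z"
    and forward: "\<And>k z. z \<in> X \<Longrightarrow> norm (ziter X T (int k) (P z)) \<le> \<alpha> k * norm z"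
    and backward: "\<And>k z. z \<in> X \<Longrightarrow> norm (ziter X T (- int k) (Q z)) \<le> \<beta> k * norm z"
    and summable: "summable \<alpha>" "summable \<beta>" and nonneg: "\<And>k. 0 \<le> \<alpha> k" "\<And>k. 0 \<le> \<beta> k"
  shows "shadowing_on X T"
  unfolding shadowing_on_def
proof (intro allI impI)
  fix \<epsilon> :: real assume \<epsilon>: "0 < \<epsilon>"
  interpret T: bounded_linear T
    by (rule T(1))
  define \<beta>' where "\<beta>' = (\<lambda>k. \<beta> (Suc k))"
  have \<beta>': "summable \<beta>'" "\<And>k. 0 \<le> \<beta>' k"
    using summable(2) nonneg(2) by (simp_all add: \<beta>'_def summable_Suc_iff)
  define S where "S = suminf \<alpha> + suminf \<beta>'"
  have S: "0 \<le> S"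
    using nonneg(1) \<beta>' summable(1) by (simp add: S_def suminf_nonneg)
  define \<delta> where "\<delta> = \<epsilon> / (S + 1)"
  have \<delta>: "0 < \<delta>" "S * \<delta> < \<epsilon>"
    using S \<epsilon> by (simp_all add: \<delta>_def field_simps)
  have "\<exists>v\<in>X. \<forall>j. norm (x j - ziter X T j v) < \<epsilon>"
    if x: "\<And>j. x j \<in> X" "\<And>j. norm (T (x j) - x (j + 1)) \<le> \<delta>" for x :: "int \<Rightarrow> 'b"
  proof -
    define z where "z = (\<lambda>j. x (j + 1) - T (x j))"
    have z: "z j \<in> X" "norm (z j) \<le> \<delta>" for j
      using x bij_betw_apply[OF T(2)] by (auto simp: z_def norm_minus_commute intro!: subspace_diff[OF X(2)])
    define A where "A = (\<lambda>j k. ziter X T (int k) (P (z (j - 1 - int k))))"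
    define B where "B = (\<lambda>j k. ziter X T (- int (Suc k)) (Q (z (j + int k))))"
    have A_norm: "norm (A j k) \<le> \<alpha> k * \<delta>" for j k
      using forward[OF z(1)[of "j - 1 - int k"], of k] nonneg(1)[of k] mult_left_mono[OF z(2)]
      unfolding A_def by (meson order_trans)
    have B_norm: "norm (B j k) \<le> \<beta>' k * \<delta>" for j k
      using backward[OF z(1)[of "j + int k"], of "Suc k"] \<beta>'(2)[of k] mult_left_mono[OF z(2)]
      unfolding B_def \<beta>'_def by (meson order_trans)
    have bounds: "summable (\<lambda>k. \<alpha> k * \<delta>)" "summable (\<lambda>k. \<beta>' k * \<delta>)"
      using summable(1) \<beta>'(1) by (simp_all add: summable_mult2)
    have A_summable: "summable (A j)" for j
      using A_norm bounds(1) by (intro summable_comparison_test[of "A j"]) auto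
    have B_summable: "summable (B j)" for j
      using B_norm bounds(2) by (intro summable_comparison_test[of "B j"]) auto
    have A_mem: "A j k \<in> X" and B_mem: "B j k \<in> X" for j k
      using ziter_in[OF T(2)] split z(1) by (simp_all add: A_def B_def)
    define y where "y = (\<lambda>j. suminf (A j) - suminf (B j))"
    have y_mem: "y j \<in> X" for j
      unfolding y_def
      by (intro subspace_diff[OF X(2)] suminf_mem[OF X] A_mem B_mem A_summable B_summable)
    have y_norm: "norm (y j) < \<epsilon>" for j
    proof -
      have "norm (suminf (A j)) \<le> (\<Sum>k. \<alpha> k * \<delta>)" "norm (suminf (B j)) \<le> (\<Sum>k. \<beta>' k * \<delta>)"
        using A_norm B_norm bounds by (auto intro!: norm_suminf_le)
      then have "norm (y j) \<le> (\<Sum>k. \<alpha> k * \<delta>) + (\<Sum>k. \<beta>' k * \<delta>)"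
        unfolding y_def by (meson add_mono norm_triangle_ineq4 order_trans)
      also have "\<dots> = S * \<delta>"
        using summable(1) \<beta>'(1) by (simp add: S_def suminf_mult2[symmetric] distrib_right)
      finally show ?thesis
        using \<delta>(2) by simp
    qed
    have y_step: "y (j + 1) = T (y j) + z j" for j
    proof -
      have TA: "T (A j k) = A (j + 1) (Suc k)" for k
        using ziter_step[OF T(2) split(1)[OF z(1)[of "j - 1 - int k"]], of "int k"]
        by (simp add: A_def algebra_simps)
      have TB0: "T (B j 0) = Q (z j)"
        using ziter_step[OF T(2) split(2)[OF z(1)[of j]], of "- 1"] by (simp add: B_def)
      have TB: "T (B j (Suc k)) = B (j + 1) k" for k
        using ziter_step[OF T(2) split(2)[OF z(1)[of "j + 1 + int k"]], of "- int (Suc (Suc k))"]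
        by (simp add: B_def add.assoc)
      have "T (suminf (A j)) = (\<Sum>k. A (j + 1) (Suc k))"
        using T.suminf[OF A_summable] TA by simp
      also have "\<dots> = suminf (A (j + 1)) - P (z j)"
        using suminf_split_head[OF A_summable[of "j + 1"]] by (simp add: A_def)
      finally have 1: "T (suminf (A j)) = suminf (A (j + 1)) - P (z j)" .
      have "(\<Sum>k. T (B j (Suc k))) = (\<Sum>k. T (B j k)) - T (B j 0)"
        by (rule suminf_split_head[OF T.summable[OF B_summable]])
      then have 2: "T (suminf (B j)) = suminf (B (j + 1)) + Q (z j)"
        using T.suminf[OF B_summable, of j] TB TB0 by simp
      show ?thesis
        using split(3)[OF z(1)[of j]] by (simp add: y_def T.diff 1 2 algebra_simps)
    qed
    define e where "e = (\<lambda>j. x j - y j)"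
    have e_mem: "e j \<in> X" for j
      unfolding e_def using x(1) y_mem by (intro subspace_diff[OF X(2)])
    have "e (j + 1) = T (e j)" for j
      by (simp add: e_def y_step T.diff z_def)
    then have "ziter X T j (e 0) = e j" for j
      using ziter_eqI[of T X e, OF T(2) e_mem] by simp
    then have "norm (x j - ziter X T j (e 0)) < \<epsilon>" for j
      using y_norm[of j] by (simp add: e_def)
    then show ?thesis
      using e_mem[of 0] by blast
  qed
  then show "\<exists>\<delta>>0. \<forall>x. (\<forall>j. x j \<in> X) \<and> (\<forall>j. norm (T (x j) - x (j + 1)) \<le> \<delta>) \<longrightarrow>
      (\<exists>v\<in>X. \<forall>j. norm (x j - ziter X T j v) < \<epsilon>)"
    using \<delta>(1) by blast
qed

section \<open>Weighted composition operators\<close>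

instance bcontfun :: (metric_space, banach) banach ..

locale isometric_weighted_system =
  fixes f :: "'a::metric_space \<Rightarrow> 'a"
    and w :: "'a \<Rightarrow> 'k::{real_normed_field, euclidean_space}"
  assumes system: "invertible_system f w"
    and uniformly_continuous: "uniformly_continuous_on UNIV w"
    and isometry: "\<forall>x y. dist (f x) (f y) = dist x y"
begin

lemma bij: "bij f"
proof (rule o_bij)
  show "inv f \<circ> f = id" "f \<circ> inv f = id"
    using system by (auto simp: invertible_system_def homeomorphism_def)
qed

lemma weight_lower: obtains m where "0 < m" "\<And>x. m \<le> norm (w x)"
proof
  show "0 < (INF x. norm (w x))"
    using system by (simp add: invertible_system_def)
  show "(INF x. norm (w x)) \<le> norm (w x)" for x
    by (intro cINF_lower) (auto intro: bdd_belowI[of _ 0])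
qed

lemma weight_upper: obtains M where "\<And>x. norm (w x) \<le> M"
  using system by (auto simp: invertible_system_def bdd_above_def)

lemma weight_nonzero: "\<forall>x. w x \<noteq> 0"
  using weight_lower by (metis norm_zero not_less)

sublocale isometric_cocycle "ziter UNIV f" "\<lambda>n x. norm (wprod f w n x)"
proof
  fix m n :: int and x y :: 'a
  show "ziter UNIV f (m + n) x = ziter UNIV f m (ziter UNIV f n x)"
    by (rule ziter_add[OF bij])
  show "dist (ziter UNIV f n x) (ziter UNIV f n y) = dist x y"
    by (rule dist_ziter[OF bij isometry])
  show "0 < norm (wprod f w n x)"
    using wprod_nonzero[OF weight_nonzero] by simp
  show "norm (wprod f w (m + n) x)
      = norm (wprod f w m (ziter UNIV f n x)) * norm (wprod f w n x)"
    by (simp add: wprod_add[OF bij weight_nonzero] norm_mult)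
next
  obtain m where m: "0 < m" "\<And>x. m \<le> norm (w x)"
    using weight_lower by blast
  obtain M where M: "\<And>x. norm (w x) \<le> M"
    using weight_upper by blast
  have "norm (wprod f w (- 1) x) \<le> 1 / m" for x
  proof -
    have "wprod f w (- 1) x = 1 / w (ziter UNIV f (- 1) x)"
      by (simp add: wprod_def)
    then show ?thesis
      using m by (simp add: norm_divide frac_le)
  qed
  then show "\<exists>B. \<forall>x. norm (wprod f w 1 x) \<le> B \<and> norm (wprod f w (- 1) x) \<le> B"
    using M by (intro exI[of _ "max M (1 / m)"]) (simp add: wprod_1[OF weight_nonzero] le_max_iff_disj)
  fix q :: real assume q: "1 < q"
  then have "0 < m * (q - 1)"
    using m(1) by simp
  then obtain r where r: "0 < r" "\<And>x y. dist x y < r \<Longrightarrow> dist (w x) (w y) < m * (q - 1)"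
    using uniformly_continuous unfolding uniformly_continuous_on_def
    by (metis UNIV_I dist_commute)
  have "norm (w x) \<le> q * norm (w y)" if "dist x y < r" for x y
  proof -
    have "norm (w x) \<le> norm (w y) + m * (q - 1)"
      using r(2)[OF that] norm_triangle_ineq2[of "w x" "w y"] by (simp add: dist_norm)
    also have "\<dots> \<le> norm (w y) + norm (w y) * (q - 1)"
      using m(2) q by (simp add: mult_right_mono)
    finally show ?thesis
      by (simp add: algebra_simps)
  qed
  then show "\<exists>r>0. \<forall>x y. dist x y < r \<longrightarrow> norm (wprod f w 1 x) \<le> q * norm (wprod f w 1 y)"
    using r(1) by (auto simp: wprod_1[OF weight_nonzero])
qed simp

lemma wprod_bounded: "\<exists>C. \<forall>x. norm (wprod f w n x) \<le> C"
  using bounded[of n] by blast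

lemma bounded_linear_wcomp: "bounded_linear (wcomp w f)"
proof -
  obtain M where M: "\<And>x. norm (w x) \<le> M"
    using weight_upper by blast
  show ?thesis
  proof (rule bounded_linear_intro)
    show "norm (wcomp w f \<psi>) \<le> norm \<psi> * M" for \<psi> :: "'a \<Rightarrow>\<^sub>C 'k"
    proof (rule norm_bound)
      show "norm (wcomp w f \<psi> x) \<le> norm \<psi> * M" for x
        unfolding wcomp_apply[OF system] norm_mult
        using M by (intro mult_mono norm_bounded) auto
    qed
  qed (auto intro!: bcontfun_eqI simp: wcomp_apply[OF system] distrib_right)
qed

lemma ziter_wcomp_apply:
  assumes X: "bij_betw (wcomp w f) X X" "\<psi> \<in> X"
  shows "ziter X (wcomp w f) n \<psi> x = \<psi> (ziter UNIV f n x) * wprod f w n x"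
proof (induction n arbitrary: x rule: int_induct[of _ 0])
  case (step1 i)
  then show ?case
    using wprod_add[OF bij weight_nonzero, of i 1 x] ziter_add[OF bij, of i 1 x]
    by (simp add: ziter_step[OF X] wcomp_apply[OF system] wprod_1[OF weight_nonzero] ziter_1[OF bij])
next
  case (step2 i)
  obtain y where x: "x = f y"
    using bij by (metis bij_pointE)
  have "ziter X (wcomp w f) (i - 1) \<psi> (f y) * w y = ziter X (wcomp w f) i \<psi> y"
    using ziter_step[OF X, of "i - 1"] by (simp add: wcomp_apply[OF system])
  also have "\<dots> = \<psi> (ziter UNIV f (i - 1) (f y)) * wprod f w (i - 1) (f y) * w y"
    using wprod_add[OF bij weight_nonzero, of "i - 1" 1 y] ziter_add[OF bij, of "i - 1" 1 y] step2
    by (simp add: wprod_1[OF weight_nonzero] ziter_1[OF bij])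
  finally show ?case
    using weight_nonzero by (simp add: x)
qed simp

text \<open>
  Only the weights on \<open>B\<close> matter for a function whose \<open>n\<close>-th translate vanishes off \<open>B\<close>: this is why
  cutting off with \<open>\<rho>\<^sub>\<plusminus>\<close> turns sup norms over the whole space into those over \<open>\<Omega>\<^sub>\<plusminus>\<^sup>n\<close>.
\<close>

lemma norm_ziter_wcomp_le:
  assumes X: "bij_betw (wcomp w f) X X" "\<psi> \<in> X"
    and vanish: "\<And>x. \<psi> (ziter UNIV f n x) \<noteq> 0 \<Longrightarrow> x \<in> B"
  shows "norm (ziter X (wcomp w f) n \<psi>) \<le> supnorm_on B (wprod f w n) * norm \<psi>"
proof (rule norm_bound)
  fix x
  obtain C where C: "\<And>x. norm (wprod f w n x) \<le> C"
    using wprod_bounded by blast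
  show "norm (ziter X (wcomp w f) n \<psi> x) \<le> supnorm_on B (wprod f w n) * norm \<psi>"
  proof (cases "x \<in> B")
    case True
    then have "norm (wprod f w n x) * norm (\<psi> (ziter UNIV f n x))
        \<le> supnorm_on B (wprod f w n) * norm \<psi>"
      using norm_le_supnorm_on[OF True C] supnorm_on_nonneg[of "wprod f w n" C, OF C]
      by (intro mult_mono norm_bounded) auto
    then show ?thesis
      by (simp add: ziter_wcomp_apply[OF X] norm_mult mult.commute)
  next
    case False
    then have "\<psi> (ziter UNIV f n x) = 0"
      using vanish by blast
    then show ?thesis
      using supnorm_on_nonneg[of "wprod f w n" C B, OF C] by (simp add: ziter_wcomp_apply[OF X])
  qed
qed

lemma bump:
  obtains b :: "'a \<Rightarrow>\<^sub>C 'k" where "compact (supp (apply_bcontfun b))" "b p = 1" "norm b \<le> 1"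
proof -
  have "locally_compact_space (euclidean :: 'a topology)"
    using system by (simp add: invertible_system_def)
  then obtain U K where K: "open U" "compact K" "p \<in> U" "U \<subseteq> K"
    unfolding locally_compact_space_def by (auto simp flip: open_openin) metis
  obtain r where r: "0 < r" "ball p r \<subseteq> U"
    using K(1,3) by (auto simp: open_contains_ball)
  define h :: "'a \<Rightarrow> 'k" where "h = (\<lambda>x. of_real (max 0 (1 - 2 * dist p x / r)))"
  have cont: "continuous_on UNIV h"
    unfolding h_def by (intro continuous_intros) (use r in auto)
  have le: "norm (h x) \<le> 1" for x
    using r(1) by (simp add: h_def)
  have "h \<in> bcontfun"
    by (rule bcontfun_normI[OF cont le])
  then obtain b where b: "h = apply_bcontfun b"
    by (rule bcontfunE)
  have "dist p x \<le> r / 2" if "h x \<noteq> 0" for x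
    using that r(1) by (simp add: h_def max_def field_simps split: if_splits)
  then have "supp h \<subseteq> cball p (r / 2)"
    unfolding supp_def by (intro closure_minimal) auto
  also have "\<dots> \<subseteq> K"
    using r K(4) by (auto simp: subset_eq)
  finally have "compact (supp h)"
    using K(2) by (metis closed_closure compact_Int_closed inf.absorb_iff2 supp_def)
  moreover have "norm b \<le> 1"
    using le by (intro norm_bound) (simp add: b)
  moreover have "h p = 1"
    by (simp add: h_def)
  ultimately show ?thesis
    using that[of b] by (simp add: b)
qed

text \<open>
  Fix \<open>x\<close> and put a bump at \<open>f\<^sup>n x\<close> into the error made at time \<open>- n - 1\<close>, for \<open>n < b\<close>, with the
  phase for which all the errors add up. The values of the shadowing defect along
  \<open>(- n, f\<^sup>n x)\<close>, multiplied by \<open>w\<^bsup>[n]\<^esup> x\<close>, then form a telescoping sequence.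
\<close>

lemma shadowing_imp_sum_bound:
  fixes X :: "('a \<Rightarrow>\<^sub>C 'k) set"
  assumes X: "bij_betw (wcomp w f) X X" and subspace: "closed_subspace X"
    and compact_support: "{\<psi>. compact (supp (apply_bcontfun \<psi>))} \<subseteq> X"
    and shadowing: "shadowing_on X (wcomp w f)"
  obtains \<delta> where "0 < \<delta>"
    "\<And>x b. \<delta> * (\<Sum>n<b. norm (wprod f w (int n) x)) \<le> 1 + norm (wprod f w (int b) x)"
proof -
  let ?T = "wcomp w f :: ('a \<Rightarrow>\<^sub>C 'k) \<Rightarrow> _"
  interpret T: bounded_linear ?T
    by (rule bounded_linear_wcomp)
  have X0: "0 \<in> X" and X_add: "\<And>\<phi> \<psi>. \<phi> \<in> X \<Longrightarrow> \<psi> \<in> X \<Longrightarrow> \<phi> + \<psi> \<in> X"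
    and X_scale: "\<And>c \<phi>. \<phi> \<in> X \<Longrightarrow> bc_scale c \<phi> \<in> X"
    using subspace by (auto simp: closed_subspace_def)
  obtain \<delta> where \<delta>: "0 < \<delta>"
    and shadow: "\<And>x. (\<And>j. x j \<in> X) \<Longrightarrow> (\<And>j. norm (?T (x j) - x (j + 1)) \<le> \<delta>) \<Longrightarrow>
      \<exists>v\<in>X. \<forall>j. norm (x j - ziter X ?T j v) < 1"
    using shadowing unfolding shadowing_on_def by (metis zero_less_one)
  have "\<delta> * (\<Sum>n<b. norm (wprod f w (int n) x)) \<le> 1 + norm (wprod f w (int b) x)" for x b
  proof -
    define g where "g = (\<lambda>n. wprod f w (int n) x)"
    define p where "p = (\<lambda>n. ziter UNIV f (int n) x)"
    have g0: "g n \<noteq> 0" for n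
      unfolding g_def by (rule wprod_nonzero[OF weight_nonzero])
    obtain \<eta> :: "nat \<Rightarrow> 'a \<Rightarrow>\<^sub>C 'k" where
      \<eta>: "\<And>n. compact (supp (apply_bcontfun (\<eta> n)))" "\<And>n. \<eta> n (p n) = 1" "\<And>n. norm (\<eta> n) \<le> 1"
    proof -
      have "\<exists>b :: 'a \<Rightarrow>\<^sub>C 'k. compact (supp (apply_bcontfun b)) \<and> b (p n) = 1 \<and> norm b \<le> 1" for n
        using bump by metis
      then show ?thesis
        using that by metis
    qed
    define z where "z = (\<lambda>n. bc_scale (of_real (\<delta> * norm (g n)) / g n) (\<eta> n))"
    have z_apply: "z n y = of_real (\<delta> * norm (g n)) / g n * \<eta> n y" for n y
      by (simp add: z_def bc_scale_def bc_mult.rep_eq)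
    have z_mem: "z n \<in> X" for n
      unfolding z_def using \<eta>(1) compact_support by (intro X_scale) auto
    have z_norm: "norm (z n) \<le> \<delta>" for n
    proof (rule norm_bound)
      fix y
      have "norm (\<eta> n y) \<le> 1"
        using norm_bounded[of "\<eta> n" y] \<eta>(3)[of n] by linarith
      then show "norm (z n y) \<le> \<delta>"
        using \<delta> g0[of n] by (simp add: z_apply norm_mult norm_divide)
    qed
    define err where "err = (\<lambda>k. if k < b then z (b - Suc k) else 0)"
    define y where "y = rec_nat 0 (\<lambda>k u. ?T u + err k)"
    have y: "y 0 = 0" "y (Suc k) = ?T (y k) + err k" for k
      by (simp_all add: y_def)
    have y_mem: "y k \<in> X" for k
    proof (induction k)
      case (Suc k)
      then show ?case
        using X0 X_add z_mem bij_betw_apply[OF X] by (simp add: y err_def)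
    qed (simp add: y X0)
    \<comment> \<open>\<^term>\<open>nat\<close> truncates, so the pseudo-orbit rests at 0 up to time \<open>- b\<close>.\<close>
    define \<xi> where "\<xi> = (\<lambda>j. y (nat (j + int b)))"
    have \<xi>_step: "\<xi> (j + 1) = ?T (\<xi> j) + (if - int b \<le> j then err (nat (j + int b)) else 0)" for j
    proof (cases "- int b \<le> j")
      case True
      then have "nat (j + 1 + int b) = Suc (nat (j + int b))"
        by simp
      then show ?thesis
        using True by (simp add: \<xi>_def y)
    next
      case False
      then show ?thesis
        by (simp add: \<xi>_def y T.zero)
    qed
    have "norm (?T (\<xi> j) - \<xi> (j + 1)) \<le> \<delta>" for j
      using \<delta> z_norm by (simp add: \<xi>_step err_def)
    then obtain v where v: "v \<in> X" "\<And>j. norm (\<xi> j - ziter X ?T j v) < 1"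
      using shadow[of \<xi>] y_mem by (auto simp: \<xi>_def)
    define D where "D = (\<lambda>j. \<xi> j - ziter X ?T j v)"
    define u where "u = (\<lambda>n. D (- int n) (p n))"
    have u_norm: "norm (u n) \<le> 1" for n
      using norm_bounded[of "D (- int n)" "p n"] v(2)[of "- int n"] by (simp add: u_def D_def)
    have recursion: "u n * g n = u (Suc n) * g (Suc n) + of_real (\<delta> * norm (g n))" if "n < b" for n
    proof -
      have "- int n = - int (Suc n) + 1"
        by simp
      moreover have "D (- int (Suc n) + 1) = ?T (D (- int (Suc n))) + z n"
      proof -
        have "nat (- int (Suc n) + int b) = b - Suc n" "b - Suc (b - Suc n) = n"
          using that by auto
        then show ?thesis
          using that unfolding D_def \<xi>_step ziter_step[OF X v(1)] T.diff
          by (simp add: err_def)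
      qed
      ultimately have "u n = D (- int (Suc n)) (f (p n)) * w (p n) + z n (p n)"
        unfolding u_def by (simp only: plus_bcontfun.rep_eq wcomp_apply[OF system])
      moreover have "f (p n) = p (Suc n)"
        using ziter_step[OF bij, of x "int n"] by (simp add: p_def add.commute)
      moreover have "g (Suc n) = w (p n) * g n"
        using wprod_step[OF weight_nonzero, of f "int n" x] by (simp add: g_def p_def add.commute)
      ultimately show ?thesis
        using g0[of n] by (simp add: u_def z_apply \<eta>(2) distrib_right)
    qed
    have "of_real (\<delta> * (\<Sum>n<k. norm (g n))) = u 0 * g 0 - u k * g k" if "k \<le> b" for k
      using that
    proof (induction k)
      case (Suc k)
      then show ?case
        using recursion[of k] by (simp add: distrib_left)
    qed simp
    then have "of_real (\<delta> * (\<Sum>n<b. norm (g n))) = u 0 * g 0 - u b * g b"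
      by blast
    then have "norm (of_real (\<delta> * (\<Sum>n<b. norm (g n))) :: 'k) \<le> norm (u 0 * g 0) + norm (u b * g b)"
      using norm_triangle_ineq4 by metis
    also have "\<dots> \<le> 1 * 1 + 1 * norm (g b)"
      unfolding norm_mult using u_norm by (intro add_mono mult_mono) (auto simp: g_def)
    finally show ?thesis
      unfolding norm_of_real g_def by linarith
  qed
  then show ?thesis
    using that \<delta> by blast
qed

lemma closure_ziter:
  assumes "x \<in> closure S" "ziter UNIV f n ` S \<subseteq> S'"
  shows "ziter UNIV f n x \<in> closure S'"
  unfolding closure_approachable
proof (intro allI impI)
  fix e :: real assume "0 < e"
  then obtain y where "y \<in> S" "dist y x < e"
    using assms(1) by (auto simp: closure_approachable)
  then show "\<exists>y\<in>S'. dist y (ziter UNIV f n x) < e"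
    using assms(2) flow_isometry[of n y x] by (intro bexI[of _ "ziter UNIV f n y"]) auto
qed

lemma ziter_Omega_minus:
  assumes "x \<in> Omega_minus f W m" "int n \<le> int m + j"
  shows "ziter UNIV f (- j) x \<in> Omega_minus f W n"
proof -
  have "ziter UNIV f (- j) (ziter UNIV f (- int k) y) \<in> (\<Union>k\<in>{n..}. ziter UNIV f (- int k) ` W)"
    if "m \<le> k" "y \<in> W" for k y
  proof (rule UN_I[of "nat (int k + j)"])
    show "ziter UNIV f (- j) (ziter UNIV f (- int k) y) \<in> ziter UNIV f (- int (nat (int k + j))) ` W"
      using that assms(2) ziter_add[OF bij, of "- j" "- int k" y] by (simp add: image_iff algebra_simps) metis
  qed (use that assms(2) in auto)
  then show ?thesis
    using assms(1) unfolding Omega_minus_def by (elim closure_ziter) auto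
qed

lemma ziter_Omega_plus:
  assumes "x \<in> Omega_plus f W m" "int n \<le> int m + j"
  shows "ziter UNIV f j x \<in> Omega_plus f W n"
proof -
  have "ziter UNIV f j (ziter UNIV f (int k) y) \<in> (\<Union>k\<in>{n..}. ziter UNIV f (int k) ` W)"
    if "m \<le> k" "y \<in> W" for k y
  proof (rule UN_I[of "nat (int k + j)"])
    show "ziter UNIV f j (ziter UNIV f (int k) y) \<in> ziter UNIV f (int (nat (int k + j))) ` W"
      using that assms(2) ziter_add[OF bij, of j "int k" y] by (simp add: image_iff algebra_simps) metis
  qed (use that assms(2) in auto)
  then show ?thesis
    using assms(1) unfolding Omega_plus_def by (elim closure_ziter) auto
qed

lemma summable_supnorm:
  assumes "\<exists>L<1. (\<lambda>n. root n (supnorm_on (B n) (wprod f w (\<sigma> n)))) \<longlonglongrightarrow> L"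
  shows "summable (\<lambda>n. supnorm_on (B n) (wprod f w (\<sigma> n)))"
proof -
  obtain L where L: "L < 1" "(\<lambda>n. root n (supnorm_on (B n) (wprod f w (\<sigma> n)))) \<longlonglongrightarrow> L"
    using assms by blast
  have "0 \<le> supnorm_on (B n) (wprod f w (\<sigma> n))" for n
    using wprod_bounded[of "\<sigma> n"] supnorm_on_nonneg by metis
  then have "(\<lambda>n. root n (norm (supnorm_on (B n) (wprod f w (\<sigma> n))))) \<longlonglongrightarrow> L"
    using L(2) by simp
  then show ?thesis
    using L(1) by (rule root_test_convergence)
qed

text \<open>
  The three spectral conditions are all instances: a constant cut-off 1 gives the pure forward or the pure backward
  solution, and the empty set then stands for the side that is absent.
\<close>

lemma shadowing_from_cutoffs:
  fixes X :: "('a \<Rightarrow>\<^sub>C 'k) set"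
  assumes T: "bij_betw (wcomp w f) X X" and X: "closed_subspace X"
    and mult: "\<And>\<psi>. \<psi> \<in> X \<Longrightarrow> bc_mult a \<psi> \<in> X" "\<And>\<psi>. \<psi> \<in> X \<Longrightarrow> bc_mult b \<psi> \<in> X"
    and cutoff: "norm a \<le> 1" "norm b \<le> 1" "\<And>x. a x + b x = 1"
    and support: "\<And>n x. a (ziter UNIV f (int n) x) \<noteq> 0 \<Longrightarrow> x \<in> Bm n"
      "\<And>n x. b (ziter UNIV f (- int n) x) \<noteq> 0 \<Longrightarrow> x \<in> Bp n"
    and limit: "\<exists>L<1. (\<lambda>n. root n (supnorm_on (Bm n) (wprod f w (int n)))) \<longlonglongrightarrow> L"
      "\<exists>L<1. (\<lambda>n. root n (supnorm_on (Bp n) (wprod f w (- int n)))) \<longlonglongrightarrow> L"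
  shows "shadowing_on X (wcomp w f)"
proof (rule shadowing_from_splitting[where P = "bc_mult a" and Q = "bc_mult b"])
  have contraction: "norm (bc_mult h \<psi>) \<le> norm \<psi>" if "norm h \<le> 1" for h \<psi> :: "'a \<Rightarrow>\<^sub>C 'k"
  proof (rule norm_bound)
    fix x
    have "norm (h x) * norm (\<psi> x) \<le> 1 * norm \<psi>"
      using norm_bounded[of h x] that by (intro mult_mono norm_bounded) auto
    then show "norm (bc_mult h \<psi> x) \<le> norm \<psi>"
      by (simp add: bc_mult.rep_eq norm_mult)
  qed
  show nonneg: "0 \<le> supnorm_on (Bm k) (wprod f w (int k))"
    "0 \<le> supnorm_on (Bp k) (wprod f w (- int k))" for k
    using wprod_bounded supnorm_on_nonneg by metis+
  fix k and \<psi> :: "'a \<Rightarrow>\<^sub>C 'k" assume \<psi>: "\<psi> \<in> X"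
  show "norm (ziter X (wcomp w f) (int k) (bc_mult a \<psi>))
      \<le> supnorm_on (Bm k) (wprod f w (int k)) * norm \<psi>"
    using support(1)
    by (intro order_trans[OF norm_ziter_wcomp_le[OF T mult(1)[OF \<psi>], where B = "Bm k"]]
        mult_left_mono contraction cutoff nonneg) (auto simp: bc_mult.rep_eq)
  show "norm (ziter X (wcomp w f) (- int k) (bc_mult b \<psi>))
      \<le> supnorm_on (Bp k) (wprod f w (- int k)) * norm \<psi>"
    using support(2)
    by (intro order_trans[OF norm_ziter_wcomp_le[OF T mult(2)[OF \<psi>], where B = "Bp k"]]
        mult_left_mono contraction cutoff nonneg) (auto simp: bc_mult.rep_eq)
  show "bc_mult a \<psi> + bc_mult b \<psi> = \<psi>"
    using cutoff(3) by (intro bcontfun_eqI) (simp add: bc_mult.rep_eq flip: distrib_right)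
next
  have "r *\<^sub>R \<psi> = bc_scale (of_real r) \<psi>" for r and \<psi> :: "'a \<Rightarrow>\<^sub>C 'k"
    by (rule bcontfun_eqI) (simp add: bc_scale_def bc_mult.rep_eq scaleR_conv_of_real)
  then show "subspace X"
    using X by (simp add: subspace_def closed_subspace_def)
  show "closed X"
    using X by (simp add: closed_subspace_def)
qed (fact bounded_linear_wcomp T mult summable_supnorm[OF limit(1)] summable_supnorm[OF limit(2)])+

end

section \<open>The characterization of shadowing\<close>

theorem theorem32:
  fixes f :: "'a::metric_space \<Rightarrow> 'a"
    and w :: "'a \<Rightarrow> 'k::{real_normed_field, euclidean_space}"
    and W :: "'a set"
    and X :: "('a \<Rightarrow>\<^sub>C 'k) set"
  assumes "invertible_system f w"
    and "uniformly_continuous_on UNIV w"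
    and "\<forall>x y. dist (f x) (f y) = dist x y"
    and "admissible_space f w W X"
  shows "shadowing_on X (wcomp w f) \<longleftrightarrow>
      (\<exists>L<1. (\<lambda>n. root n (supnorm_on UNIV (wprod f w (int n)))) \<longlonglongrightarrow> L)
    \<or> (\<exists>L<1. (\<lambda>n. root n (supnorm_on UNIV (wprod f w (- int n)))) \<longlonglongrightarrow> L)
    \<or> ((\<exists>L<1. (\<lambda>n. root n (supnorm_on (Omega_minus f W n) (wprod f w (int n)))) \<longlonglongrightarrow> L)
       \<and> (\<exists>L<1. (\<lambda>n. root n (supnorm_on (Omega_plus f W n) (wprod f w (- int n)))) \<longlonglongrightarrow> L))"
    (is "_ \<longleftrightarrow> ?A \<or> ?B \<or> ?Cm \<and> ?Cp")
proof -
  interpret isometric_weighted_system f w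
    using assms(1-3) by unfold_locales
  let ?T = "wcomp w f :: ('a \<Rightarrow>\<^sub>C 'k) \<Rightarrow> _"
  have W: "compact (closure W)" "connected W" and sweep: "(\<Union>k. ziter UNIV f k ` W) = UNIV"
    and closed: "closed_subspace X" and T: "bij_betw ?T X X"
    and compact_support: "{\<psi>. compact (supp (apply_bcontfun \<psi>))} \<subseteq> X"
    using assms(4)
    by (simp_all add: admissible_space_def generating_set_def invertible_operator_on_def)
  have "\<exists>\<rho>m \<rho>p :: 'a \<Rightarrow>\<^sub>C 'k.
        (\<forall>\<psi>\<in>X. bc_mult \<rho>m \<psi> \<in> X \<and> bc_mult \<rho>p \<psi> \<in> X) \<and>
        norm \<rho>m = 1 \<and> norm \<rho>p = 1 \<and>
        supp \<rho>m = Omega_minus f W 0 \<and> supp \<rho>p = Omega_plus f W 0 \<and>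
        (\<forall>x. \<rho>m x + \<rho>p x = 1)"
    using assms(4) unfolding admissible_space_def by (elim conjE)
  then obtain \<rho>m \<rho>p :: "'a \<Rightarrow>\<^sub>C 'k" where
    mult: "\<forall>\<psi>\<in>X. bc_mult \<rho>m \<psi> \<in> X \<and> bc_mult \<rho>p \<psi> \<in> X"
    and norm_\<rho>: "norm \<rho>m = 1" "norm \<rho>p = 1"
    and supp_\<rho>: "supp \<rho>m = Omega_minus f W 0" "supp \<rho>p = Omega_plus f W 0"
    and sum_\<rho>: "\<forall>x. \<rho>m x + \<rho>p x = 1"
    by (elim exE conjE)
  have nonempty: "W \<noteq> {}"
    using sweep by auto
  have zero: "0 \<in> X"
    using closed by (simp add: closed_subspace_def)
  have one_mult: "bc_mult (const_bcontfun 1) \<psi> = \<psi>" and zero_mult: "bc_mult 0 \<psi> = 0"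
    for \<psi> :: "'a \<Rightarrow>\<^sub>C 'k"
    by (auto intro!: bcontfun_eqI simp: bc_mult.rep_eq)
  have norm_one: "norm (const_bcontfun 1 :: 'a \<Rightarrow>\<^sub>C 'k) \<le> 1"
    by (rule norm_bound) simp
  have "?A \<or> ?B \<or> ?Cm \<and> ?Cp" if shadowing: "shadowing_on X ?T"
  proof -
    obtain \<delta> where \<delta>: "0 < \<delta>"
      "\<And>x b. \<delta> * (\<Sum>n<b. norm (wprod f w (int n) x)) \<le> 1 + norm (wprod f w (int b) x)"
      using shadowing_imp_sum_bound[OF T closed compact_support shadowing] by blast
    have A: ?A if "\<exists>n\<ge>1. \<forall>x. norm (wprod f w (int n) x) \<le> 1 / 2"
    proof -
      from that obtain n where n: "1 \<le> n" "\<And>x. norm (wprod f w (int n) x) \<le> 1 / 2"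
        by blast
      show ?thesis
        by (rule supnorm_root_limit[where g = "\<lambda>n. ziter UNIV f (int n)" and n = n])
          (use n wprod_bounded in \<open>simp_all add: wprod_add[OF bij weight_nonzero]
            wprod_nonzero[OF weight_nonzero]\<close>)
    qed
    have B: ?B if "\<exists>n\<ge>1. \<forall>x. norm (wprod f w (- int n) x) \<le> 1 / 2"
    proof -
      from that obtain n where n: "1 \<le> n" "\<And>x. norm (wprod f w (- int n) x) \<le> 1 / 2"
        by blast
      have "wprod f w (- int (m + n)) x
          = wprod f w (- int m) (ziter UNIV f (- int n) x) * wprod f w (- int n) x" for m n x
        using wprod_add[OF bij weight_nonzero, of "- int m" "- int n" x] by (simp add: algebra_simps)
      then show ?thesis
        by (intro supnorm_root_limit[where g = "\<lambda>n. ziter UNIV f (- int n)" and n = n])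
          (use n wprod_bounded in \<open>simp_all add: wprod_nonzero[OF weight_nonzero]\<close>)
    qed
    have Cm: ?Cm if "\<exists>n\<ge>1. \<forall>x\<in>W. \<forall>k\<ge>n. norm (wprod f w (int n) (ziter UNIV f (- int k) x)) \<le> 1 / 2"
    proof -
      from that obtain n where n: "1 \<le> n"
        "\<And>x k. x \<in> W \<Longrightarrow> n \<le> k \<Longrightarrow> norm (wprod f w (int n) (ziter UNIV f (- int k) x)) \<le> 1 / 2"
        by blast
      have small: "norm (wprod f w (int n) x) \<le> 1 / 2" if "x \<in> Omega_minus f W n" for x
        using that n(2) unfolding Omega_minus_def by (elim le_on_closure) auto
      have "x \<in> Omega_minus f W n \<and> ziter UNIV f (int n) x \<in> Omega_minus f W m"
        if "x \<in> Omega_minus f W (m + n)" for m n x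
        using ziter_Omega_minus[OF that, of n 0] ziter_Omega_minus[OF that, of m "- int n"] by simp
      moreover have "Omega_minus f W n \<noteq> {}" for n
        using nonempty by (auto simp: Omega_minus_def)
      ultimately show ?thesis
        by (intro supnorm_root_limit[where g = "\<lambda>n. ziter UNIV f (int n)" and n = n])
          (use n(1) small wprod_bounded in \<open>simp_all add: wprod_add[OF bij weight_nonzero]
            wprod_nonzero[OF weight_nonzero]\<close>)
    qed
    have Cp: ?Cp if "\<exists>n\<ge>1. \<forall>x\<in>W. \<forall>k\<ge>n. norm (wprod f w (- int n) (ziter UNIV f (int k) x)) \<le> 1 / 2"
    proof -
      from that obtain n where n: "1 \<le> n"
        "\<And>x k. x \<in> W \<Longrightarrow> n \<le> k \<Longrightarrow> norm (wprod f w (- int n) (ziter UNIV f (int k) x)) \<le> 1 / 2"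
        by blast
      have small: "norm (wprod f w (- int n) x) \<le> 1 / 2" if "x \<in> Omega_plus f W n" for x
        using that n(2) unfolding Omega_plus_def by (elim le_on_closure) auto
      have "x \<in> Omega_plus f W n \<and> ziter UNIV f (- int n) x \<in> Omega_plus f W m"
        if "x \<in> Omega_plus f W (m + n)" for m n x
        using ziter_Omega_plus[OF that, of n 0] ziter_Omega_plus[OF that, of m "- int n"] by simp
      moreover have "Omega_plus f W n \<noteq> {}" for n
        using nonempty by (auto simp: Omega_plus_def)
      moreover have "wprod f w (- int (m + n)) x
          = wprod f w (- int m) (ziter UNIV f (- int n) x) * wprod f w (- int n) x" for m n x
        using wprod_add[OF bij weight_nonzero, of "- int m" "- int n" x] by (simp add: algebra_simps)
      ultimately show ?thesis
        by (intro supnorm_root_limit[where g = "\<lambda>n. ziter UNIV f (- int n)" and n = n])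
          (use n(1) small wprod_bounded in \<open>simp_all add: wprod_nonzero[OF weight_nonzero]\<close>)
    qed
    show ?thesis
      using trichotomy[OF \<delta> W sweep] A B Cm Cp by blast
  qed
  moreover have "shadowing_on X ?T" if A: ?A
  proof (rule shadowing_from_cutoffs[OF T closed, where a = "const_bcontfun 1" and b = 0
        and Bm = "\<lambda>_. UNIV" and Bp = "\<lambda>_. {}"])
    show "\<exists>L<1. (\<lambda>n. root n (supnorm_on {} (wprod f w (- int n)))) \<longlonglongrightarrow> L"
      by (intro exI[of _ 0]) (simp add: supnorm_on_def)
  qed (use A zero in \<open>simp_all add: one_mult zero_mult norm_one\<close>)
  moreover have "shadowing_on X ?T" if B: ?B
  proof (rule shadowing_from_cutoffs[OF T closed, where a = 0 and b = "const_bcontfun 1"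
        and Bm = "\<lambda>_. {}" and Bp = "\<lambda>_. UNIV"])
    show "\<exists>L<1. (\<lambda>n. root n (supnorm_on {} (wprod f w (int n)))) \<longlonglongrightarrow> L"
      by (intro exI[of _ 0]) (simp add: supnorm_on_def)
  qed (use B zero in \<open>simp_all add: one_mult zero_mult norm_one\<close>)
  moreover have "shadowing_on X ?T" if C: "?Cm \<and> ?Cp"
  proof (rule shadowing_from_cutoffs[OF T closed, where a = \<rho>m and b = \<rho>p
        and Bm = "Omega_minus f W" and Bp = "Omega_plus f W"])
    show "x \<in> Omega_minus f W n" if "\<rho>m (ziter UNIV f (int n) x) \<noteq> 0" for n x
    proof -
      have "ziter UNIV f (int n) x \<in> Omega_minus f W 0"
        using that closure_subset by (force simp: supp_def simp flip: supp_\<rho>(1))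
      then show ?thesis
        using ziter_Omega_minus[of "ziter UNIV f (int n) x" W 0 n "int n"] by simp
    qed
    show "x \<in> Omega_plus f W n" if "\<rho>p (ziter UNIV f (- int n) x) \<noteq> 0" for n x
    proof -
      have "ziter UNIV f (- int n) x \<in> Omega_plus f W 0"
        using that closure_subset by (force simp: supp_def simp flip: supp_\<rho>(2))
      then show ?thesis
        using ziter_Omega_plus[of "ziter UNIV f (- int n) x" W 0 n "int n"] by simp
    qed
  qed (use C mult norm_\<rho> sum_\<rho> in simp_all)
  ultimately show ?thesis
    by blast
qed

end
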